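(* Let $G$ be a finite group, let $(\mathscr L_K)_{K\le G}$ be an admissible family of nonempty sublattices of a finite $G$-lattice $\mathscr L$ (see context), and let $H\leq G$. Define a map $\zeta_H:\mho(H,M_{\mathscr L})\to\widetilde{\Omega}(H,M_{\mathscr L})$ by $$\Bigl(\sum_{s\in\mathscr L_K}\ell_{(K,s)}s\Bigr)_{K\leq H}\mapsto\Bigl(\sum_{s\in\mathscr L_U,\ t\leq s}\ell_{(U,s)}\Bigr)_{(U,t)\in\mathcal R(H,M_{\mathscr L})}.$$ Then $\alpha_H\circ\varphi_H=\zeta_H\circ\rho_H$ as maps $\Omega(H,M_{\mathscr L})\to\widetilde\Omega(H,M_{\mathscr L})$. Moreover, the map $\alpha_H\circ\varphi_H:\Omega(H,M_{\mathscr L})\to\widetilde\Omega(H,M_{\mathscr L})$ is an injective ring homomorphism, and the primitive idempotents of $\mathbb Q\otimes_{\mathbb Z}\Omega(H,M_{\mathscr L})$ are the elements $$e_{(K,s)}^{(H)}:=\frac{1}{|N_H(K,s)|}\sum_{t\in\mathscr L_K,\ t\leq s}\mu_K(t,s)\sum_{U\leq K}|U|\,\mu(U,K)\,\bigl[(H/U)_{t\wedge\sup\mathscr L_U}\bigr]$$ for $(K,s)\in\mathcal R(H,M_{\mathscr L})$.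
   Context: Write ${}^gH=gHg^{-1}$. A finite $G$-lattice is a finite lattice $\mathscr L$ with an order-preserving left $G$-action $(g,s)\mapsto{}^gs$. An admissible family consists of nonempty sublattices $\mathscr L_H\subseteq\mathscr L$, $H\leq G$, such that for all $K\le H\leq G$, $g\in G$: (1) $\mathscr L_{{}^gH}=\{{}^gs\mid s\in\mathscr L_H\}$; (2) ${}^hs=s$ for $h\in H$, $s\in\mathscr L_H$; (3) $s\wedge\sup\mathscr L_K\in\mathscr L_K$ for $s\in\mathscr L_H$; (4) $\sup\mathscr L_K\leq\sup\mathscr L_H$. Then $M_{\mathscr L}(H)=\mathscr L_H$ is a monoid under $\wedge$ (identity $\sup\mathscr L_H$), with conjugation maps $s\mapsto{}^gs$ and restriction maps $\mathrm{res}_K^H(s)=s\wedge\sup\mathscr L_K$. For $H\leq G$ let $\mathcal S(H,M_{\mathscr L})=\{(K,s)\mid K\leq H,\ s\in\mathscr L_K\}$ with $H$-action $h.(K,s)=({}^hK,{}^hs)$, and let $\mathcal R(H,M_{\mathscr L})$ be a complete set of representatives of the $H$-orbits, chosen so that the first components $K$ lie in a fixed set of representatives of the conjugacy classes of subgroups of $H$. Put $N_H(K,s)=\{h\in H\mid{}^hK=K,\ {}^hs=s\}$. The lattice Burnside ring $\Omega(H,M_{\mathscr L})$ is the free abelian group with basis $[(H/K)_s]$, $(K,s)\in\mathcal R(H,M_{\mathscr L})$, where $[(H/K)_s]$ is defined for all $(K,s)\in\mathcal S(H,M_{\mathscr L})$ by $[(H/{}^hK)_{{}^hs}]=[(H/K)_s]$,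 with multiplication $$[(H/K)_s]\cdot[(H/U)_t]=\sum_{KhU\in K\backslash H/U}\bigl[(H/(K\cap{}^hU))_{s\wedge{}^ht\wedge\sup\mathscr L_{K\cap{}^hU}}\bigr].$$ (It is the Grothendieck ring of pairs $(J,\pi)$ of a finite left $H$-set $J$ and an $H$-equivariant map $\pi$ from $J$ to the disjoint union of the $\mathscr L_K$, $K\le H$, with $\pi(x)\in\mathscr L_{H_x}$ for the stabilizer $H_x$; $(H/K)_s$ is the pair $(H/K,\ hK\mapsto{}^hs)$.) $\widetilde\Omega(H,M_{\mathscr L})=\prod_{(K,s)\in\mathcal R(H,M_{\mathscr L})}\mathbb Z$ as a ring with componentwise operations; for an element $(x_{(K,s)})$ and $(U,t)\in\mathcal S(H,M_{\mathscr L})$, set $x_{(U,t)}=x_{(K,s)}$ where $(K,s)\in\mathcal R(H,M_{\mathscr L})$ is in the $H$-orbit of $(U,t)$. $\varphi_H:\Omega(H,M_{\mathscr L})\to\widetilde\Omega(H,M_{\mathscr L})$ is the additive map $[(H/K)_s]\mapsto\bigl(|\{hK\in H/K\mid U\leq{}^hK,\ t={}^hs\wedge\sup\mathscr L_U\}|\bigr)_{(U,t)\in\mathcal R(H,M_{\mathscr L})}$. $\alpha_H:\widetilde\Omega(H,M_{\mathscr L})\to\widetilde\Omega(H,M_{\mathscr L})$ is $(x_{(K,s)})\mapsto\bigl(\sum_{s\in\mathscr L_U,\,s\geq t}x_{(U,s)}\bigr)_{(U,t)\in\mathcal R(H,M_{\mathscr L})}$. For $U\leq H$ let $\mathbb Z\mathscr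 L_U$ be the monoid ring of $(\mathscr L_U,\wedge)$. $\mho(H,M_{\mathscr L})$ is the subring of $\prod_{U\leq H}\mathbb Z\mathscr L_U$ of families $(x_U)_{U\le H}$ such that, for all $h\in H$, $x_{{}^hU}$ is the image of $x_U$ under the linear extension of $s\mapsto{}^hs$. The mark homomorphism is the ring homomorphism $\rho_H:\Omega(H,M_{\mathscr L})\to\mho(H,M_{\mathscr L})$, $[(H/K)_s]\mapsto\bigl(\sum_{hK\in H/K,\,U\leq{}^hK}{}^hs\wedge\sup\mathscr L_U\bigr)_{U\leq H}$, where the sum is taken in the monoid ring $\mathbb Z\mathscr L_U$. $\mu$ is the Möbius function of the poset of subgroups of $G$ ordered by inclusion, and $\mu_K$ is the Möbius function of the poset $\mathscr L_K$. *)

theory Defs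
  imports "HOL-Algebra.Algebra"
begin

section \<open>Group actions, transversals, Moebius functions\<close>

definition conj_set :: "('g, 'm) monoid_scheme \<Rightarrow> 'g \<Rightarrow> 'g set \<Rightarrow> 'g set" where
  "conj_set G g H = g <#\<^bsub>G\<^esub> H #>\<^bsub>G\<^esub> (inv\<^bsub>G\<^esub> g)"

definition subgroups_of :: "('g, 'm) monoid_scheme \<Rightarrow> 'g set \<Rightarrow> 'g set set" where
  "subgroups_of G H = {K. subgroup K G \<and> K \<subseteq> H}"

text \<open>\<open>R\<close> is a complete set of representatives of the \<open>H\<close>-orbits on \<open>A\<close>.\<close>

definition transversal :: "'g set \<Rightarrow> ('g \<Rightarrow> 'x \<Rightarrow> 'x) \<Rightarrow> 'x set \<Rightarrow> 'x set \<Rightarrow> bool" where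
  "transversal H a A R \<longleftrightarrow> R \<subseteq> A \<and> (\<forall>x\<in>A. \<exists>!r. r \<in> R \<and> (\<exists>h\<in>H. a h x = r))"

definition orbit_rep :: "'g set \<Rightarrow> ('g \<Rightarrow> 'x \<Rightarrow> 'x) \<Rightarrow> 'x set \<Rightarrow> 'x \<Rightarrow> 'x" where
  "orbit_rep H a R x = (THE r. r \<in> R \<and> (\<exists>h\<in>H. a h x = r))"

text \<open>The Moebius function of a finite subset \<open>P\<close> of an ordered type, regarded as a poset with
  the induced order.\<close>

function moebius :: "'a::order set \<Rightarrow> 'a \<Rightarrow> 'a \<Rightarrow> int" where
  "moebius P x y =
     (if finite P \<and> x \<in> P \<and> y \<in> P \<and> x \<le> y
      then if x = y then 1 else - (\<Sum>z\<in>{z \<in> P. x \<le> z \<and> z < y}. moebius P x z)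
      else 0)"
  by pat_completeness auto
termination
proof (relation "Wellfounded.measure (\<lambda>(P, x, y). card {z \<in> P. z < y})", goal_cases)
  case 1
  then show ?case by simp
next
  case (2 P x y z)
  then have "z \<in> P" "z < y" "finite P" by auto
  then have "{w \<in> P. w < z} \<subset> {w \<in> P. w < y}" by (auto intro: less_trans)
  with \<open>finite P\<close> show ?case by (simp add: psubset_card_mono)
qed

declare moebius.simps [simp del]


section \<open>Admissible families in a finite \<open>G\<close>-lattice\<close>

locale finite_G_lattice = group_action G "UNIV :: 'l set" act
  for G :: "('g, 'm) monoid_scheme" (structure)
    and act :: "'g \<Rightarrow> 'l \<Rightarrow> 'l::{finite, lattice}" +
  assumes act_mono: "\<lbrakk>g \<in> carrier G; s \<le> t\<rbrakk> \<Longrightarrow> act g s \<le> act g t"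

locale admissible_family = finite_G_lattice G act
  for G :: "('g, 'm) monoid_scheme" (structure)
    and act :: "'g \<Rightarrow> 'l \<Rightarrow> 'l::{finite, lattice}" +
  fixes L :: "'g set \<Rightarrow> 'l set"
  assumes nonempty: "subgroup H G \<Longrightarrow> L H \<noteq> {}"
    and inf_closed: "\<lbrakk>subgroup H G; s \<in> L H; t \<in> L H\<rbrakk> \<Longrightarrow> inf s t \<in> L H"
    and sup_closed: "\<lbrakk>subgroup H G; s \<in> L H; t \<in> L H\<rbrakk> \<Longrightarrow> sup s t \<in> L H"
    and conj_image: "\<lbrakk>subgroup H G; g \<in> carrier G\<rbrakk> \<Longrightarrow> L (conj_set G g H) = act g ` L H"
    and fixed: "\<lbrakk>subgroup H G; h \<in> H; s \<in> L H\<rbrakk> \<Longrightarrow> act h s = s"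
    and restriction: "\<lbrakk>subgroup H G; subgroup K G; K \<subseteq> H; s \<in> L H\<rbrakk>
                      \<Longrightarrow> inf s (Sup_fin (L K)) \<in> L K"
    and top_mono: "\<lbrakk>subgroup H G; subgroup K G; K \<subseteq> H\<rbrakk>
                   \<Longrightarrow> Sup_fin (L K) \<le> Sup_fin (L H)"

definition pairs :: "('g, 'm) monoid_scheme \<Rightarrow> ('g set \<Rightarrow> 'l set) \<Rightarrow> 'g set \<Rightarrow> ('g set \<times> 'l) set" where
  "pairs G L H = {(K, s). K \<in> subgroups_of G H \<and> s \<in> L K}"

definition conj_pair ::
  "('g, 'm) monoid_scheme \<Rightarrow> ('g \<Rightarrow> 'l \<Rightarrow> 'l) \<Rightarrow> 'g \<Rightarrow> 'g set \<times> 'l \<Rightarrow> 'g set \<times> 'l" where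
  "conj_pair G act h = (\<lambda>(K, s). (conj_set G h K, act h s))"

text \<open>\<open>C\<close> is the fixed set of representatives of the conjugacy classes of subgroups of \<open>H\<close> in
  which the first components of the elements of \<open>R\<close> are required to lie.\<close>

definition pair_reps ::
  "('g, 'm) monoid_scheme \<Rightarrow> ('g \<Rightarrow> 'l \<Rightarrow> 'l) \<Rightarrow> ('g set \<Rightarrow> 'l set) \<Rightarrow> 'g set \<Rightarrow>
   'g set set \<Rightarrow> ('g set \<times> 'l) set \<Rightarrow> bool" where
  "pair_reps G act L H C R \<longleftrightarrow>
     transversal H (conj_set G) (subgroups_of G H) C \<and>
     transversal H (conj_pair G act) (pairs G L H) R \<and>
     fst ` R \<subseteq> C"

definition pair_normalizer ::
  "('g, 'm) monoid_scheme \<Rightarrow> ('g \<Rightarrow> 'l \<Rightarrow> 'l) \<Rightarrow> 'g set \<Rightarrow> 'g set \<times> 'l \<Rightarrow> 'g set" where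
  "pair_normalizer G act H p = {h \<in> H. conj_pair G act h p = p}"


section \<open>Free modules and products of rings\<close>

text \<open>The free module over a commutative ring \<open>'c\<close> with basis \<open>B\<close> consists of the
  \<open>x :: 'b \<Rightarrow>\<^sub>0 'c\<close> with \<open>keys x \<subseteq> B\<close>; for \<open>'c = int\<close> this is the carrier of
  \<open>free_Abelian_group B\<close>, and \<open>scale\<close> and \<open>lin_extend\<close> are \<open>frag_cmul\<close> and \<open>frag_extend\<close>
  (lemmas below).\<close>

definition scale :: "'c::comm_ring_1 \<Rightarrow> ('b \<Rightarrow>\<^sub>0 'c) \<Rightarrow> ('b \<Rightarrow>\<^sub>0 'c)" where
  "scale c x = Poly_Mapping.map ((*) c) x"

definition lin_extend :: "('a \<Rightarrow> ('b \<Rightarrow>\<^sub>0 'c)) \<Rightarrow> ('a \<Rightarrow>\<^sub>0 'c::comm_ring_1) \<Rightarrow> ('b \<Rightarrow>\<^sub>0 'c)" where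
  "lin_extend f x = (\<Sum>a\<in>Poly_Mapping.keys x. scale (Poly_Mapping.lookup x a) (f a))"

lemma lookup_scale [simp]: "Poly_Mapping.lookup (scale c x) k = c * Poly_Mapping.lookup x k"
  unfolding scale_def by transfer (simp add: when_def)

lemma scale_int_eq_frag_cmul: "scale c x = frag_cmul c x"
  by (rule poly_mapping_eqI) simp

lemma lin_extend_int_eq_frag_extend: "lin_extend f x = frag_extend f x"
  by (simp add: lin_extend_def frag_extend_def scale_int_eq_frag_cmul)

definition product_ring :: "'i set \<Rightarrow> ('i \<Rightarrow> ('b, 'n) ring_scheme) \<Rightarrow> ('i \<Rightarrow> 'b) ring" where
  "product_ring I S =
     \<lparr>carrier = (\<Pi>\<^sub>E i\<in>I. carrier (S i)),
      monoid.mult = (\<lambda>x y. \<lambda>i\<in>I. x i \<otimes>\<^bsub>S i\<^esub> y i),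
      monoid.one = (\<lambda>i\<in>I. \<one>\<^bsub>S i\<^esub>),
      ring.zero = (\<lambda>i\<in>I. \<zero>\<^bsub>S i\<^esub>),
      ring.add = (\<lambda>x y. \<lambda>i\<in>I. x i \<oplus>\<^bsub>S i\<^esub> y i)\<rparr>"

definition primitive_idempotent :: "('a, 'n) ring_scheme \<Rightarrow> 'a \<Rightarrow> bool" where
  "primitive_idempotent S e \<longleftrightarrow>
     e \<in> carrier S \<and> e \<noteq> \<zero>\<^bsub>S\<^esub> \<and> e \<otimes>\<^bsub>S\<^esub> e = e \<and>
     \<not> (\<exists>f\<in>carrier S. \<exists>g\<in>carrier S.
          f \<noteq> \<zero>\<^bsub>S\<^esub> \<and> g \<noteq> \<zero>\<^bsub>S\<^esub> \<and> f \<otimes>\<^bsub>S\<^esub> f = f \<and> g \<otimes>\<^bsub>S\<^esub> g = g \<and>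
          f \<otimes>\<^bsub>S\<^esub> g = \<zero>\<^bsub>S\<^esub> \<and> g \<otimes>\<^bsub>S\<^esub> f = \<zero>\<^bsub>S\<^esub> \<and> e = f \<oplus>\<^bsub>S\<^esub> g)"


section \<open>The lattice Burnside ring\<close>

text \<open>The basis element \<open>[(H/K)\<^sub>s]\<close> for an arbitrary pair \<open>p = (K, s)\<close>, i.e. the basis vector of
  the representative in \<open>R\<close> of the \<open>H\<close>-orbit of \<open>p\<close>.\<close>

definition basis ::
  "('g, 'm) monoid_scheme \<Rightarrow> ('g \<Rightarrow> 'l \<Rightarrow> 'l) \<Rightarrow> 'g set \<Rightarrow> ('g set \<times> 'l) set \<Rightarrow>
   'g set \<times> 'l \<Rightarrow> ('g set \<times> 'l \<Rightarrow>\<^sub>0 'c::comm_ring_1)" where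
  "basis G act H R p = Poly_Mapping.single (orbit_rep H (conj_pair G act) R p) 1"

text \<open>A coset or double coset \<open>D\<close> contributes to a sum through an arbitrary element
  \<open>SOME h. h \<in> D\<close>; in the sums below the summand does not depend on that choice.\<close>

definition double_cosets :: "('g, 'm) monoid_scheme \<Rightarrow> 'g set \<Rightarrow> 'g set \<Rightarrow> 'g set \<Rightarrow> 'g set set" where
  "double_cosets G K H U = {K <#>\<^bsub>G\<^esub> (h <#\<^bsub>G\<^esub> U) |h. h \<in> H}"

definition basis_mult ::
  "('g, 'm) monoid_scheme \<Rightarrow> ('g \<Rightarrow> 'l \<Rightarrow> 'l) \<Rightarrow> ('g set \<Rightarrow> 'l set) \<Rightarrow> 'g set \<Rightarrow>
   ('g set \<times> 'l) set \<Rightarrow> 'g set \<times> 'l \<Rightarrow> 'g set \<times> 'l \<Rightarrow>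
   ('g set \<times> 'l::lattice \<Rightarrow>\<^sub>0 'c::comm_ring_1)" where
  "basis_mult G act L H R = (\<lambda>(K, s) (U, t).
     \<Sum>D\<in>double_cosets G K H U.
       let h = (SOME h. h \<in> D); V = K \<inter> conj_set G h U
       in basis G act H R (V, inf (inf s (act h t)) (Sup_fin (L V))))"

text \<open>The algebra over \<open>'c\<close> with basis the \<open>[(H/K)\<^sub>s]\<close>, \<open>(K, s) \<in> R\<close>, and the above structure
  constants.\<close>

definition burnside_algebra ::
  "('g, 'm) monoid_scheme \<Rightarrow> ('g \<Rightarrow> 'l \<Rightarrow> 'l) \<Rightarrow> ('g set \<Rightarrow> 'l set) \<Rightarrow> 'g set \<Rightarrow>
   ('g set \<times> 'l) set \<Rightarrow> ('g set \<times> 'l::lattice \<Rightarrow>\<^sub>0 'c::comm_ring_1) ring" where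
  "burnside_algebra G act L H R =
     \<lparr>carrier = {x. Poly_Mapping.keys x \<subseteq> R},
      monoid.mult = (\<lambda>x y. lin_extend (\<lambda>p. lin_extend (\<lambda>q. basis_mult G act L H R p q) y) x),
      monoid.one = basis G act H R (H, Sup_fin (L H)),
      ring.zero = 0,
      ring.add = (+)\<rparr>"

definition Omega ::
  "('g, 'm) monoid_scheme \<Rightarrow> ('g \<Rightarrow> 'l \<Rightarrow> 'l) \<Rightarrow> ('g set \<Rightarrow> 'l set) \<Rightarrow> 'g set \<Rightarrow>
   ('g set \<times> 'l) set \<Rightarrow> ('g set \<times> 'l::lattice \<Rightarrow>\<^sub>0 int) ring" where
  "Omega G act L H R = burnside_algebra G act L H R"

text \<open>As \<open>Omega\<close> is a free abelian group on \<open>R\<close>, its scalar extension \<open>\<rat> \<otimes>\<^sub>\<int> Omega\<close> is the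
  rational vector space with basis \<open>R\<close> and the same structure constants, \<open>q \<otimes> [(H/K)\<^sub>s]\<close>
  being \<open>scale q (basis \<dots> (K, s))\<close>. The lemmas on \<open>rationalize\<close> below verify that
  \<open>x \<mapsto> 1 \<otimes> x\<close> is an injective homomorphism and that every element is \<open>(1/n) \<otimes> x\<close> for some
  \<open>n > 0\<close> and some \<open>x\<close> in \<open>Omega\<close>.\<close>

definition Omega_rat ::
  "('g, 'm) monoid_scheme \<Rightarrow> ('g \<Rightarrow> 'l \<Rightarrow> 'l) \<Rightarrow> ('g set \<Rightarrow> 'l set) \<Rightarrow> 'g set \<Rightarrow>
   ('g set \<times> 'l) set \<Rightarrow> ('g set \<times> 'l::lattice \<Rightarrow>\<^sub>0 rat) ring" where
  "Omega_rat G act L H R = burnside_algebra G act L H R"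


subsection \<open>\<open>Omega_rat\<close> is the rationalization of \<open>Omega\<close>\<close>

definition rationalize :: "('b \<Rightarrow>\<^sub>0 int) \<Rightarrow> ('b \<Rightarrow>\<^sub>0 rat)" where
  "rationalize x = Poly_Mapping.map of_int x"

lemma lookup_rationalize [simp]:
  "Poly_Mapping.lookup (rationalize x) k = of_int (Poly_Mapping.lookup x k)"
  unfolding rationalize_def by transfer (simp add: when_def)

lemma keys_rationalize [simp]: "Poly_Mapping.keys (rationalize x) = Poly_Mapping.keys x"
  by (auto simp: in_keys_iff)

lemma rationalize_add: "rationalize (x + y) = rationalize x + rationalize y"
  by (rule poly_mapping_eqI) (simp add: lookup_add)

lemma rationalize_sum: "rationalize (sum f A) = (\<Sum>a\<in>A. rationalize (f a))"
proof -
  have "rationalize 0 = (0 :: 'a \<Rightarrow>\<^sub>0 rat)" by (rule poly_mapping_eqI) simp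
  then show ?thesis by (induction A rule: infinite_finite_induct) (simp_all add: rationalize_add)
qed

lemma rationalize_scale: "rationalize (scale c x) = scale (of_int c) (rationalize x)"
  by (rule poly_mapping_eqI) simp

lemma rationalize_lin_extend:
  "rationalize (lin_extend f x) = lin_extend (\<lambda>a. rationalize (f a)) (rationalize x)"
  by (simp add: lin_extend_def rationalize_sum rationalize_scale)

lemma rationalize_basis: "rationalize (basis G act H R p) = basis G act H R p"
  by (rule poly_mapping_eqI) (simp add: basis_def lookup_single when_def)

lemma rationalize_basis_mult:
  "rationalize (basis_mult G act L H R p q) = basis_mult G act L H R p q"
  by (simp add: basis_mult_def rationalize_sum rationalize_basis Let_def split: prod.split)

lemma rationalize_hom: "rationalize \<in> ring_hom (Omega G act L H R) (Omega_rat G act L H R)"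
  by (rule ring_hom_memI)
    (auto simp: Omega_def Omega_rat_def burnside_algebra_def rationalize_add rationalize_basis
      rationalize_lin_extend rationalize_basis_mult dest: subsetD)

lemma inj_rationalize: "inj rationalize"
proof (rule injI)
  fix x y :: "'b \<Rightarrow>\<^sub>0 int"
  assume "rationalize x = rationalize y"
  then have "of_int (Poly_Mapping.lookup x k) = (of_int (Poly_Mapping.lookup y k) :: rat)" for k
    by (metis lookup_rationalize)
  then show "x = y" by (intro poly_mapping_eqI) simp
qed

lemma common_denominator:
  assumes "finite A"
  shows "\<exists>n>0. \<forall>a\<in>A. \<exists>m. of_int n * (f a :: rat) = of_int m"
  using assms
proof (induction A)
  case empty
  show ?case by (intro exI[of _ 1]) simp
next
  case (insert a A)
  then obtain n where n: "n > 0" "\<forall>a\<in>A. \<exists>m. of_int n * f a = of_int m" by blast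
  obtain p d where pd: "f a = Fract p d" "d > 0" by (cases "f a") auto
  have "\<exists>m. of_int (n * d) * f b = of_int m" if "b \<in> insert a A" for b
  proof (cases "b = a")
    case True
    with pd have "of_int (n * d) * f b = of_int (n * p)" by (simp add: Fract_of_int_quotient)
    then show ?thesis by blast
  next
    case False
    with that n obtain m where "of_int n * f b = of_int m" by blast
    then have "of_int (n * d) * f b = of_int (m * d)" by (simp add: mult.commute mult.left_commute)
    then show ?thesis by blast
  qed
  with n pd show ?case by (intro exI[of _ "n * d"]) simp
qed

lemma Omega_rat_denominator:
  assumes "x \<in> carrier (Omega_rat G act L H R)"
  shows "\<exists>n>0. \<exists>y\<in>carrier (Omega G act L H R). x = scale (1 / of_int n) (rationalize y)"
proof -
  obtain n where n: "n > 0"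
    "\<forall>a\<in>Poly_Mapping.keys x. \<exists>m. of_int n * Poly_Mapping.lookup x a = of_int m"
    using common_denominator[of "Poly_Mapping.keys x" "Poly_Mapping.lookup x"] by auto
  define c where "c a = \<lfloor>of_int n * Poly_Mapping.lookup x a\<rfloor>" for a
  have c: "of_int (c a) = of_int n * Poly_Mapping.lookup x a" for a
    using n(2) by (cases "a \<in> Poly_Mapping.keys x") (auto simp: c_def in_keys_iff)
  define y where "y = Abs_poly_mapping c"
  have "{a. c a \<noteq> 0} \<subseteq> Poly_Mapping.keys x"
    by (auto simp: c_def in_keys_iff)
  then have "finite {a. c a \<noteq> 0}" by (rule finite_subset) simp
  then have y: "Poly_Mapping.lookup y = c" by (simp add: y_def)
  have "Poly_Mapping.keys y \<subseteq> Poly_Mapping.keys x"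
    using \<open>{a. c a \<noteq> 0} \<subseteq> _\<close> by (auto simp: in_keys_iff y)
  with assms have "y \<in> carrier (Omega G act L H R)"
    by (auto simp: Omega_def Omega_rat_def burnside_algebra_def)
  moreover have "x = scale (1 / of_int n) (rationalize y)"
    using n(1) by (intro poly_mapping_eqI) (simp add: y c)
  ultimately show ?thesis using n(1) by blast
qed


section \<open>The ghost rings and the maps between them\<close>

definition Omega_tilde :: "('g set \<times> 'l) set \<Rightarrow> ('g set \<times> 'l \<Rightarrow> int) ring" where
  "Omega_tilde R = product_ring R (\<lambda>_. \<Z>)"

definition meet_monoid_ring :: "'l set \<Rightarrow> ('l::lattice \<Rightarrow>\<^sub>0 int) ring" where
  "meet_monoid_ring A =
     \<lparr>carrier = {x. Poly_Mapping.keys x \<subseteq> A},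
      monoid.mult = (\<lambda>x y. lin_extend (\<lambda>s. lin_extend (\<lambda>t. Poly_Mapping.single (inf s t) 1) y) x),
      monoid.one = Poly_Mapping.single (Sup_fin A) 1,
      ring.zero = 0,
      ring.add = (+)\<rparr>"

definition Mho ::
  "('g, 'm) monoid_scheme \<Rightarrow> ('g \<Rightarrow> 'l \<Rightarrow> 'l) \<Rightarrow> ('g set \<Rightarrow> 'l set) \<Rightarrow> 'g set \<Rightarrow>
   ('g set \<Rightarrow> ('l::lattice \<Rightarrow>\<^sub>0 int)) ring" where
  "Mho G act L H =
     (let P = product_ring (subgroups_of G H) (\<lambda>U. meet_monoid_ring (L U))
      in P\<lparr>carrier := {x \<in> carrier P. \<forall>h\<in>H. \<forall>U\<in>subgroups_of G H.
             x (conj_set G h U) = lin_extend (\<lambda>s. Poly_Mapping.single (act h s) 1) (x U)}\<rparr>)"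

definition phi ::
  "('g, 'm) monoid_scheme \<Rightarrow> ('g \<Rightarrow> 'l \<Rightarrow> 'l) \<Rightarrow> ('g set \<Rightarrow> 'l set) \<Rightarrow> 'g set \<Rightarrow>
   ('g set \<times> 'l) set \<Rightarrow> ('g set \<times> 'l::lattice \<Rightarrow>\<^sub>0 int) \<Rightarrow> ('g set \<times> 'l \<Rightarrow> int)" where
  "phi G act L H R x = (\<lambda>(U, t)\<in>R.
     \<Sum>(K, s)\<in>Poly_Mapping.keys x. Poly_Mapping.lookup x (K, s) *
       int (card {h <#\<^bsub>G\<^esub> K |h. h \<in> H \<and> U \<subseteq> conj_set G h K \<and> t = inf (act h s) (Sup_fin (L U))}))"

definition alpha ::
  "('g, 'm) monoid_scheme \<Rightarrow> ('g \<Rightarrow> 'l \<Rightarrow> 'l) \<Rightarrow> ('g set \<Rightarrow> 'l set) \<Rightarrow> 'g set \<Rightarrow>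
   ('g set \<times> 'l) set \<Rightarrow> ('g set \<times> 'l::lattice \<Rightarrow> int) \<Rightarrow> ('g set \<times> 'l \<Rightarrow> int)" where
  "alpha G act L H R x = (\<lambda>(U, t)\<in>R.
     \<Sum>s | s \<in> L U \<and> t \<le> s. x (orbit_rep H (conj_pair G act) R (U, s)))"

definition rho ::
  "('g, 'm) monoid_scheme \<Rightarrow> ('g \<Rightarrow> 'l \<Rightarrow> 'l) \<Rightarrow> ('g set \<Rightarrow> 'l set) \<Rightarrow> 'g set \<Rightarrow>
   ('g set \<times> 'l::lattice \<Rightarrow>\<^sub>0 int) \<Rightarrow> ('g set \<Rightarrow> ('l \<Rightarrow>\<^sub>0 int))" where
  "rho G act L H x = (\<lambda>U\<in>subgroups_of G H.
     lin_extend (\<lambda>(K, s).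
       \<Sum>D\<in>{h <#\<^bsub>G\<^esub> K |h. h \<in> H \<and> U \<subseteq> conj_set G h K}.
         Poly_Mapping.single (inf (act (SOME h. h \<in> D) s) (Sup_fin (L U))) 1) x)"

definition zeta ::
  "('g set \<Rightarrow> 'l set) \<Rightarrow> ('g set \<times> 'l) set \<Rightarrow>
   ('g set \<Rightarrow> ('l::lattice \<Rightarrow>\<^sub>0 int)) \<Rightarrow> ('g set \<times> 'l \<Rightarrow> int)" where
  "zeta L R x = (\<lambda>(U, t)\<in>R. \<Sum>s | s \<in> L U \<and> t \<le> s. Poly_Mapping.lookup (x U) s)"

definition idem ::
  "('g, 'm) monoid_scheme \<Rightarrow> ('g \<Rightarrow> 'l \<Rightarrow> 'l) \<Rightarrow> ('g set \<Rightarrow> 'l set) \<Rightarrow> 'g set \<Rightarrow>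
   ('g set \<times> 'l) set \<Rightarrow> 'g set \<times> 'l \<Rightarrow> ('g set \<times> 'l::lattice \<Rightarrow>\<^sub>0 rat)" where
  "idem G act L H R = (\<lambda>(K, s).
     scale (1 / of_nat (card (pair_normalizer G act H (K, s))))
       (\<Sum>t | t \<in> L K \<and> t \<le> s. scale (of_int (moebius (L K) t s))
         (\<Sum>U\<in>subgroups_of G K.
            scale (of_nat (card U) * of_int (moebius (subgroups_of G (carrier G)) U K))
              (basis G act H R (U, inf t (Sup_fin (L U)))))))"

end

theory Submission
  imports Defs "HOL-Library.Product_Order"
begin

text \<open>Let \<open>P\<close> be the set of pairs \<open>(K, s)\<close> with \<open>K \<le> H\<close> and \<open>s \<in> L K\<close>, ordered componentwise. The
  axioms of an admissible family imply that \<open>H\<close> acts on \<open>P\<close> by order automorphisms, that \<open>K\<close>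
  fixes \<open>(K, s)\<close>, and that any two pairs \<open>(K, s)\<close> and \<open>(U, t)\<close> have a meet in \<open>P\<close>, namely
  \<open>(K \<inter> U, s \<and> t \<and> sup L (K \<inter> U))\<close> (\<open>le_pair_meet_iff\<close>). For \<open>q = (K, s)\<close> let \<open>mark p q\<close> be the
  number of cosets \<open>h K\<close> with \<open>p \<le> h \<bullet> q\<close>, and extend it linearly in \<open>q\<close> to \<open>marks x p\<close>.

  \<^item> The entry of \<open>\<phi>\<close> at \<open>(U, s)\<close> counts the cosets whose translate of \<open>q\<close> restricts to exactly
    \<open>(U, s)\<close>. The coefficient of \<open>s\<close> in the component of \<open>\<rho>\<close> at \<open>U\<close> is the same number. Both \<open>\<alpha>\<close> and \<open>\<zeta>\<close>
    sum these numbers over all \<open>s \<ge> t\<close>, which gives the mark at \<open>(U, t)\<close> (\<open>sum_exact_mark\<close>). So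
    \<open>\<alpha> \<circ> \<phi>\<close> and \<open>\<zeta> \<circ> \<rho>\<close> both send \<open>x\<close> to its marks.

  \<^item> Marks are multiplicative (\<open>mark_product\<close>): since \<open>P\<close> has meets, the pairs \<open>(h, g)\<close> with
    \<open>w \<le> h \<bullet> p\<close> and \<open>w \<le> g \<bullet> q\<close>, written with \<open>g = h k\<close>, are those with \<open>w\<close> below the translate by \<open>h\<close>
    of the meet of \<open>p\<close> and \<open>k \<bullet> q\<close>. Collecting the \<open>k\<close> by double cosets gives the structure
    constants of the Burnside ring.

  \<^item> Marks are injective (\<open>marks_zero_imp_zero\<close>): \<open>mark p q \<noteq> 0\<close> forces \<open>p \<le> h \<bullet> q\<close> for some \<open>h\<close>, so
    the matrix of marks is triangular with nonzero diagonal. In particular the ring axioms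
    for the Burnside ring follow from those of its ghost ring.

  \<^item> By Moebius inversion in the lattice \<open>L K\<close> and in the subgroup poset, the marks of
    \<open>e\<^sub>(\<^sub>K\<^sub>,\<^sub>s\<^sub>)\<close> are the indicator function of \<open>(K, s)\<close> on \<open>R\<close> (\<open>marks_idem\<close>). An idempotent has
    marks in \<open>{0, 1}\<close>, so the primitive ones are exactly those whose marks are
    the indicator function of a single element of \<open>R\<close>.\<close>

section \<open>Sums over cosets and double cosets\<close>

lemma sum_over_blocks:
  fixes f :: "'a \<Rightarrow> 'b::semiring_1"
  assumes "finite A" and "\<Union>B = A" and "{} \<notin> B" and "pairwise disjnt B"
    and const: "\<And>D x y. D \<in> B \<Longrightarrow> x \<in> D \<Longrightarrow> y \<in> D \<Longrightarrow> f x = f y"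
  shows "sum f A = (\<Sum>D\<in>B. of_nat (card D) * f (SOME x. x \<in> D))"
proof -
  have fin: "finite D" if "D \<in> B" for D
    by (rule finite_subset[OF _ assms(1)]) (use that assms(2) in auto)
  have "\<forall>D\<in>B. \<forall>E\<in>B. D \<noteq> E \<longrightarrow> D \<inter> E = {}"
    using assms(4) unfolding pairwise_def disjnt_def by blast
  then have "sum f (\<Union>B) = (sum \<circ> sum) f B"
    using fin by (intro sum.Union_disjoint) blast+
  then have "sum f A = (\<Sum>D\<in>B. sum f D)"
    unfolding assms(2) comp_def .
  also have "\<dots> = (\<Sum>D\<in>B. of_nat (card D) * f (SOME x. x \<in> D))"
  proof (rule sum.cong[OF refl])
    fix D assume D: "D \<in> B"
    with assms(3) have "D \<noteq> {}" by auto
    then have "(SOME x. x \<in> D) \<in> D" by (simp add: some_in_eq)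
    then have "sum f D = (\<Sum>x\<in>D. f (SOME x. x \<in> D))"
      by (intro sum.cong refl const[OF D])
    then show "sum f D = of_nat (card D) * f (SOME x. x \<in> D)" by simp
  qed
  finally show ?thesis .
qed

context group
begin

lemma l_coset_mem: "x \<in> a <# K \<longleftrightarrow> (\<exists>k\<in>K. x = a \<otimes> k)"
  by (auto simp: l_coset_def)

lemma conj_set_mem: "x \<in> conj_set G g K \<longleftrightarrow> (\<exists>k\<in>K. x = g \<otimes> k \<otimes> inv g)"
  by (auto simp: conj_set_def l_coset_def r_coset_def)

lemma card_l_coset:
  assumes "K \<subseteq> carrier G" "a \<in> carrier G"
  shows "card (a <# K) = card K"
proof -
  have "a <# K = (\<lambda>k. a \<otimes> k) ` K" by (auto simp: l_coset_def)
  moreover have "inj_on (\<lambda>k. a \<otimes> k) K"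
    using assms by (auto intro!: inj_onI) (meson l_cancel subsetD)
  ultimately show ?thesis by (simp add: card_image)
qed

lemma sum_left_cosets:
  fixes f :: "'a \<Rightarrow> 'c::semiring_1"
  assumes K: "subgroup K G" and A: "finite A" "A \<subseteq> carrier G"
    and closed: "\<And>a k. a \<in> A \<Longrightarrow> k \<in> K \<Longrightarrow> a \<otimes> k \<in> A"
    and const: "\<And>a k. a \<in> A \<Longrightarrow> k \<in> K \<Longrightarrow> f (a \<otimes> k) = f a"
  shows "sum f A = of_nat (card K) * (\<Sum>D\<in>{a <# K |a. a \<in> A}. f (SOME a. a \<in> D))"
proof -
  interpret K: subgroup K G by fact
  have self: "a \<in> a <# K" if "a \<in> A" for a
    using lcos_self[OF _ K] that A by blast
  have "sum f A = (\<Sum>D\<in>{a <# K |a. a \<in> A}. of_nat (card D) * f (SOME a. a \<in> D))"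
  proof (rule sum_over_blocks)
    show "\<Union>{a <# K |a. a \<in> A} = A"
    proof (intro equalityI subsetI)
      fix x assume "x \<in> \<Union>{a <# K |a. a \<in> A}"
      then obtain a where "a \<in> A" "x \<in> a <# K" by blast
      then show "x \<in> A" using closed unfolding l_coset_mem by blast
    qed (use self in blast)
    show "{} \<notin> {a <# K |a. a \<in> A}" using self by blast
    have "a <# K = b <# K" if ab: "a \<in> A" "b \<in> A" and "x \<in> a <# K" "x \<in> b <# K" for a b x
    proof -
      from ab A have "a \<in> carrier G" "b \<in> carrier G" by blast+
      then have "a <# K = x <# K" "b <# K = x <# K"
        using l_repr_independence K that(3,4) by blast+
      then show ?thesis by simp
    qed
    then show "pairwise disjnt {a <# K |a. a \<in> A}"
      unfolding pairwise_def disjnt_iff by blast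
    show "f x = f y" if "D \<in> {a <# K |a. a \<in> A}" "x \<in> D" "y \<in> D" for D x y
    proof -
      from that(1) obtain a where a: "a \<in> A" "D = a <# K" by blast
      from that(2,3) obtain k k' where "k \<in> K" "x = a \<otimes> k" "k' \<in> K" "y = a \<otimes> k'"
        unfolding a(2) l_coset_mem by blast
      then show ?thesis using const[OF a(1)] by simp
    qed
  qed (use A in auto)
  also have "\<dots> = (\<Sum>D\<in>{a <# K |a. a \<in> A}. of_nat (card K) * f (SOME a. a \<in> D))"
  proof (rule sum.cong[OF refl])
    fix D assume "D \<in> {a <# K |a. a \<in> A}"
    then obtain a where "a \<in> A" "D = a <# K" by blast
    with A(2) have "card D = card K" using card_l_coset[OF K.subset, of a] by auto
    then show "of_nat (card D) * f (SOME a. a \<in> D) = of_nat (card K) * f (SOME a. a \<in> D)"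
      by simp
  qed
  finally show ?thesis unfolding sum_distrib_left .
qed

lemma double_coset_mem:
  assumes "h \<in> carrier G" "K \<subseteq> carrier G" "U \<subseteq> carrier G"
  shows "x \<in> K <#> (h <# U) \<longleftrightarrow> (\<exists>a\<in>K. \<exists>b\<in>U. x = a \<otimes> h \<otimes> b)"
proof -
  have "a \<otimes> (h \<otimes> b) = a \<otimes> h \<otimes> b" if "a \<in> K" "b \<in> U" for a b
    using that assms m_assoc by (metis subsetD)
  then show ?thesis by (auto simp: set_mult_def l_coset_def)
qed

text \<open>The map \<open>(a, b) \<mapsto> a h b\<close> sends \<open>K \<times> U\<close> onto the double coset. On the fibre through
  \<open>(a\<^sub>0, b\<^sub>0)\<close>, the element \<open>a\<^sub>0\<^sup>-\<^sup>1 a\<close> ranges over \<open>K \<inter> h U h\<^sup>-\<^sup>1\<close> and determines \<open>(a, b)\<close>.\<close>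

lemma card_double_coset:
  assumes K: "subgroup K G" and U: "subgroup U G" and h: "h \<in> carrier G"
    and fin: "finite K" "finite U"
  shows "card (K <#> (h <# U)) * card (K \<inter> conj_set G h U) = card K * card U"
proof -
  interpret K: subgroup K G by fact
  interpret U: subgroup U G by fact
  define m where "m = (\<lambda>(a, b). a \<otimes> h \<otimes> b)"
  define F where "F d = {z \<in> K \<times> U. m z = d}" for d
  have D: "K <#> (h <# U) = m ` (K \<times> U)"
    using double_coset_mem[OF h K.subset U.subset] by (auto simp: m_def image_iff)
  have F: "card (F d) = card (K \<inter> conj_set G h U)" if "d \<in> m ` (K \<times> U)" for d
  proof -
    from that obtain a0 b0 where ab: "a0 \<in> K" "b0 \<in> U" and d: "d = a0 \<otimes> h \<otimes> b0"
      by (auto simp: m_def)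
    note abG = K.mem_carrier[OF ab(1)] U.mem_carrier[OF ab(2)]
    have "bij_betw (\<lambda>z. inv a0 \<otimes> fst z) (F d) (K \<inter> conj_set G h U)"
    proof (rule bij_betw_imageI)
      show "inj_on (\<lambda>z. inv a0 \<otimes> fst z) (F d)"
      proof (rule inj_onI)
        fix z z' assume zz: "z \<in> F d" "z' \<in> F d" and eq: "inv a0 \<otimes> fst z = inv a0 \<otimes> fst z'"
        obtain a b a' b' where z: "z = (a, b)" "z' = (a', b')" by (cases z, cases z') auto
        with zz have mem: "a \<in> K" "b \<in> U" "a' \<in> K" "b' \<in> U"
          and e: "a \<otimes> h \<otimes> b = a' \<otimes> h \<otimes> b'"
          by (auto simp: F_def m_def)
        from eq z mem abG have "a = a'" by simp
        with e mem h have "b = b'" by simp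
        with \<open>a = a'\<close> z show "z = z'" by simp
      qed
      show "(\<lambda>z. inv a0 \<otimes> fst z) ` F d = K \<inter> conj_set G h U"
      proof (intro equalityI subsetI)
        fix x assume "x \<in> (\<lambda>z. inv a0 \<otimes> fst z) ` F d"
        then obtain a b where mem: "a \<in> K" "b \<in> U" and e: "a \<otimes> h \<otimes> b = a0 \<otimes> h \<otimes> b0"
          and x: "x = inv a0 \<otimes> a"
          by (auto simp: F_def m_def d)
        note memG = K.mem_carrier[OF mem(1)] U.mem_carrier[OF mem(2)]
        have "a = a0 \<otimes> h \<otimes> b0 \<otimes> inv b \<otimes> inv h"
          using e memG abG h by (metis inv_closed inv_solve_right m_closed)
        then have "x = h \<otimes> (b0 \<otimes> inv b) \<otimes> inv h"
          using x memG abG h by (simp add: m_assoc[symmetric])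
        moreover have "b0 \<otimes> inv b \<in> U" "x \<in> K" using mem ab x by auto
        ultimately show "x \<in> K \<inter> conj_set G h U" by (auto simp: conj_set_mem)
      next
        fix x assume "x \<in> K \<inter> conj_set G h U"
        then obtain u where u: "u \<in> U" "x = h \<otimes> u \<otimes> inv h" and xK: "x \<in> K"
          by (auto simp: conj_set_mem)
        have "(a0 \<otimes> x) \<otimes> h \<otimes> (inv u \<otimes> b0) = a0 \<otimes> h \<otimes> b0"
          using u abG h by (simp add: m_assoc) (simp add: m_assoc[symmetric])
        then have "(a0 \<otimes> x, inv u \<otimes> b0) \<in> F d"
          using u xK ab by (auto simp: F_def m_def d)
        moreover have "x = inv a0 \<otimes> (a0 \<otimes> x)"
          using abG xK by (simp add: m_assoc[symmetric])
        ultimately show "x \<in> (\<lambda>z. inv a0 \<otimes> fst z) ` F d"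
          by (metis (no_types, lifting) fst_conv image_eqI)
      qed
    qed
    then show ?thesis by (rule bij_betw_same_card)
  qed
  have "card K * card U = card (K \<times> U)" by (simp add: card_cartesian_product)
  also have "\<dots> = (\<Sum>d\<in>m ` (K \<times> U). card (F d))"
    using sum.image_gen[of "K \<times> U" "\<lambda>_. 1 :: nat" m] fin by (simp add: F_def)
  also have "\<dots> = card (m ` (K \<times> U)) * card (K \<inter> conj_set G h U)"
    using F by simp
  finally show ?thesis by (simp add: D)
qed

lemma double_coset_repr:
  assumes K: "subgroup K G" and U: "subgroup U G" and h: "h \<in> carrier G"
    and x: "x \<in> K <#> (h <# U)"
  shows "K <#> (x <# U) = K <#> (h <# U)"
proof -
  interpret K: subgroup K G by fact
  interpret U: subgroup U G by fact
  note mem = double_coset_mem[OF _ K.subset U.subset]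
  obtain a b where ab: "a \<in> K" "b \<in> U" "x = a \<otimes> h \<otimes> b"
    using x unfolding mem[OF h] by blast
  note abG = K.mem_carrier[OF ab(1)] U.mem_carrier[OF ab(2)]
  have xG: "x \<in> carrier G" using abG h ab(3) by simp
  have x_to_h: "c \<otimes> x \<otimes> d = (c \<otimes> a) \<otimes> h \<otimes> (b \<otimes> d)" if "c \<in> K" "d \<in> U" for c d
    using K.mem_carrier[OF that(1)] U.mem_carrier[OF that(2)] abG h
    by (simp add: ab(3) m_assoc)
  have h_to_x: "c \<otimes> h \<otimes> d = (c \<otimes> inv a) \<otimes> x \<otimes> (inv b \<otimes> d)" if "c \<in> K" "d \<in> U" for c d
  proof -
    note cdG = K.mem_carrier[OF that(1)] U.mem_carrier[OF that(2)]
    have "inv a \<otimes> x \<otimes> inv b = (inv a \<otimes> a) \<otimes> h \<otimes> (b \<otimes> inv b)"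
      using abG h unfolding ab(3) by (simp only: m_assoc m_closed inv_closed)
    also have "\<dots> = h" using abG h by simp
    finally have "c \<otimes> h \<otimes> d = c \<otimes> (inv a \<otimes> x \<otimes> inv b) \<otimes> d" by simp
    also have "\<dots> = (c \<otimes> inv a) \<otimes> x \<otimes> (inv b \<otimes> d)"
      using cdG abG xG by (simp only: m_assoc m_closed inv_closed)
    finally show ?thesis .
  qed
  show ?thesis
  proof (intro equalityI subsetI)
    fix y assume "y \<in> K <#> (x <# U)"
    then obtain c d where "c \<in> K" "d \<in> U" "y = c \<otimes> x \<otimes> d" using mem[OF xG] by blast
    then show "y \<in> K <#> (h <# U)"
      using x_to_h ab mem[OF h] by (metis K.m_closed U.m_closed)
  next
    fix y assume "y \<in> K <#> (h <# U)"
    then obtain c d where "c \<in> K" "d \<in> U" "y = c \<otimes> h \<otimes> d" using mem[OF h] by blast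
    then show "y \<in> K <#> (x <# U)"
      using h_to_x ab mem[OF xG] by (metis K.m_closed U.m_closed K.m_inv_closed U.m_inv_closed)
  qed
qed

context
  fixes H K U
  assumes H: "subgroup H G" "finite H" and K: "subgroup K G" "K \<subseteq> H"
    and U: "subgroup U G" "U \<subseteq> H"
begin

interpretation H: subgroup H G by (rule H)
interpretation K: subgroup K G by (rule K)
interpretation U: subgroup U G by (rule U)

lemma double_coset_self:
  assumes "h \<in> H"
  shows "h \<in> K <#> (h <# U)"
proof -
  have "h = \<one> \<otimes> h \<otimes> \<one>" using assms by simp
  then show ?thesis
    using double_coset_mem[OF H.mem_carrier[OF assms] K.subset U.subset] K.one_closed U.one_closed
    by blast
qed

lemma double_coset_subset: "h \<in> H \<Longrightarrow> K <#> (h <# U) \<subseteq> H"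
  using K(2) U(2) H.m_closed
  unfolding subset_iff double_coset_mem[OF H.mem_carrier K.subset U.subset] by blast

lemma some_in_double_coset:
  assumes "D \<in> double_cosets G K H U"
  shows "(SOME h. h \<in> D) \<in> D" "(SOME h. h \<in> D) \<in> H"
proof -
  obtain h where h: "h \<in> H" "D = K <#> (h <# U)" using assms by (auto simp: double_cosets_def)
  then have "D \<noteq> {}" using double_coset_self by blast
  then show "(SOME h. h \<in> D) \<in> D" by (simp add: some_in_eq)
  then show "(SOME h. h \<in> D) \<in> H" using double_coset_subset h by blast
qed

lemma card_double_coset_some:
  assumes "D \<in> double_cosets G K H U"
  shows "card D * card (K \<inter> conj_set G (SOME h. h \<in> D) U) = card K * card U"
proof -
  obtain h where h: "h \<in> H" "D = K <#> (h <# U)" using assms by (auto simp: double_cosets_def)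
  have "K <#> ((SOME h. h \<in> D) <# U) = D"
    using double_coset_repr[OF K(1) U(1)] h some_in_double_coset(1)[OF assms] by auto
  then show ?thesis
    using card_double_coset[OF K(1) U(1), of "SOME h. h \<in> D"] some_in_double_coset(2)[OF assms]
      finite_subset[OF K(2) H(2)] finite_subset[OF U(2) H(2)] by simp
qed

lemma sum_double_cosets:
  fixes f :: "'a \<Rightarrow> 'c::semiring_1"
  assumes const: "\<And>a h b. a \<in> K \<Longrightarrow> h \<in> H \<Longrightarrow> b \<in> U \<Longrightarrow> f (a \<otimes> h \<otimes> b) = f h"
  shows "(\<Sum>h\<in>H. f h) = (\<Sum>D\<in>double_cosets G K H U. of_nat (card D) * f (SOME h. h \<in> D))"
proof (rule sum_over_blocks)
  let ?D = "\<lambda>h. K <#> (h <# U)"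
  have B: "double_cosets G K H U = {?D h |h. h \<in> H}" by (simp add: double_cosets_def)
  show "\<Union>(double_cosets G K H U) = H"
    using double_coset_self double_coset_subset unfolding B by blast
  show "{} \<notin> double_cosets G K H U" using double_coset_self unfolding B by blast
  have "?D h = ?D h'" if "h \<in> H" "h' \<in> H" "x \<in> ?D h" "x \<in> ?D h'" for h h' x
    using double_coset_repr[OF K(1) U(1)] that by (metis H.mem_carrier)
  then show "pairwise disjnt (double_cosets G K H U)"
    unfolding B pairwise_def disjnt_iff by blast
  show "f x = f y" if "D \<in> double_cosets G K H U" "x \<in> D" "y \<in> D" for D x y
  proof -
    from that(1) obtain h where h: "h \<in> H" "D = ?D h" unfolding B by blast
    with that(2,3) const[OF _ h(1)] double_coset_mem[OF H.mem_carrier[OF h(1)] K.subset U.subset]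
    show ?thesis by metis
  qed
qed (rule H)

end

end

section \<open>Moebius inversion\<close>

lemma moebius_refl: "finite P \<Longrightarrow> x \<in> P \<Longrightarrow> moebius P x x = 1"
  by (subst moebius.simps) simp

lemma sum_moebius_right:
  assumes "finite P" "x \<in> P" "y \<in> P" "x \<le> y"
  shows "(\<Sum>z | z \<in> P \<and> x \<le> z \<and> z \<le> y. moebius P x z) = (if x = y then 1 else 0)"
proof (cases "x = y")
  case True
  then have "{z. z \<in> P \<and> x \<le> z \<and> z \<le> y} = {x}" using assms by auto
  with True assms show ?thesis by (simp add: moebius_refl)
next
  case False
  have "{z. z \<in> P \<and> x \<le> z \<and> z \<le> y} = insert y {z \<in> P. x \<le> z \<and> z < y}"
    using assms by auto
  then have "(\<Sum>z | z \<in> P \<and> x \<le> z \<and> z \<le> y. moebius P x z)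
      = moebius P x y + (\<Sum>z\<in>{z \<in> P. x \<le> z \<and> z < y}. moebius P x z)"
    using assms by simp
  also have "\<dots> = 0" using assms False by (subst moebius.simps) simp
  finally show ?thesis using False by simp
qed

text \<open>The recursion makes \<open>moebius\<close> a right inverse of the zeta function in the incidence algebra;
  the idempotent formula needs it as a left inverse. Convolving the left sums with \<open>moebius P x\<close>
  gives \<open>moebius P x y\<close> back, which determines the sum at \<open>x\<close> from the sums at larger elements.\<close>

lemma sum_moebius_left:
  assumes P: "finite P" and "x \<in> P" and y: "y \<in> P" and "x \<le> y"
  shows "(\<Sum>z | z \<in> P \<and> x \<le> z \<and> z \<le> y. moebius P z y) = (if x = y then 1 else 0)"
  using assms(2,4)
proof (induction "card {z \<in> P. x < z}" arbitrary: x rule: less_induct)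
  case (less x)
  let ?m = "moebius P"
  define F where "F w = (\<Sum>z | z \<in> P \<and> w \<le> z \<and> z \<le> y. ?m z y)" for w
  let ?I = "{z. z \<in> P \<and> x \<le> z \<and> z \<le> y}"
  have finI: "finite ?I" using P by simp
  have "(\<Sum>w\<in>?I. ?m x w * F w) = (\<Sum>w\<in>?I. \<Sum>z\<in>?I. if w \<le> z then ?m x w * ?m z y else 0)"
  proof (rule sum.cong[OF refl])
    fix w assume w: "w \<in> ?I"
    then have "{z. z \<in> P \<and> w \<le> z \<and> z \<le> y} = {z \<in> ?I. w \<le> z}"
      using order_trans by blast
    then show "?m x w * F w = (\<Sum>z\<in>?I. if w \<le> z then ?m x w * ?m z y else 0)"
      unfolding F_def by (simp only: sum_distrib_left sum.inter_filter[OF finI, symmetric])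
  qed
  also have "\<dots> = (\<Sum>z\<in>?I. (\<Sum>w\<in>?I. if w \<le> z then ?m x w else 0) * ?m z y)"
    by (subst sum.swap) (simp add: sum_distrib_right if_distrib[of "\<lambda>c. c * _"] cong: if_cong)
  also have "\<dots> = (\<Sum>z\<in>?I. (if x = z then 1 else 0) * ?m z y)"
  proof (rule sum.cong[OF refl])
    fix z assume z: "z \<in> ?I"
    have "(\<Sum>w\<in>?I. if w \<le> z then ?m x w else 0) = (\<Sum>w | w \<in> P \<and> x \<le> w \<and> w \<le> z. ?m x w)"
    proof -
      have "{w. w \<in> P \<and> x \<le> w \<and> w \<le> z} = {w \<in> ?I. w \<le> z}"
        using z order_trans by blast
      then show ?thesis by (simp only: sum.inter_filter[OF finI, symmetric])
    qed
    then show "(\<Sum>w\<in>?I. if w \<le> z then ?m x w else 0) * ?m z y = (if x = z then 1 else 0) * ?m z y"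
      using sum_moebius_right[OF P less.prems(1), of z] z by simp
  qed
  also have "\<dots> = ?m x y"
    using less.prems finI by (subst sum.remove[of _ x]) (auto intro!: sum.neutral)
  finally have conv: "(\<Sum>w\<in>?I. ?m x w * F w) = ?m x y" .
  have IH: "F w = (if w = y then 1 else 0)" if "w \<in> P" "x < w" "w \<le> y" for w
    unfolding F_def
  proof (rule less.hyps)
    have "{z \<in> P. w < z} \<subset> {z \<in> P. x < z}" using that by (auto intro: less_trans)
    then show "card {z \<in> P. w < z} < card {z \<in> P. x < z}"
      using P by (intro psubset_card_mono) auto
  qed (use that in auto)
  show ?case
  proof (cases "x = y")
    case True
    then have "?I = {x}" using less.prems by auto
    then show ?thesis using True P less.prems by (simp add: moebius_refl)
  next
    case False
    have "(\<Sum>w\<in>?I. ?m x w * F w) = F x + (\<Sum>w\<in>?I - {x}. ?m x w * F w)"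
      using less.prems P by (subst sum.remove[of _ x]) (auto simp: moebius_refl)
    also have "(\<Sum>w\<in>?I - {x}. ?m x w * F w) = (\<Sum>w\<in>?I - {x}. if w = y then ?m x w else 0)"
      using IH by (intro sum.cong) (auto simp: less_le)
    also have "\<dots> = ?m x y"
      using finI less.prems False y by (simp add: sum.delta)
    finally show ?thesis using conv False by (simp add: F_def)
  qed
qed

section \<open>The poset of pairs\<close>

locale burnside_pairs = admissible_family G act L
  for G :: "('g, 'm) monoid_scheme" (structure)
    and act :: "'g \<Rightarrow> 'l \<Rightarrow> 'l::{finite, lattice}" and L :: "'g set \<Rightarrow> 'l set" +
  fixes H :: "'g set"
  assumes finite_carrier: "finite (carrier G)" and subgroup_H: "subgroup H G"
begin

sublocale group G
  using group_hom group_hom.axioms(1) by blast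

sublocale H: subgroup H G
  by (rule subgroup_H)

abbreviation pair_act (infixr \<open>\<bullet>\<close> 75) where "h \<bullet> p \<equiv> conj_pair G act h p"

abbreviation P where "P \<equiv> pairs G L H"

lemma finite_subset_H: "K \<subseteq> H \<Longrightarrow> finite K"
  using finite_carrier H.subset finite_subset by metis

lemma finite_H: "finite H"
  by (rule finite_subset_H) simp

lemma mem_P_iff: "p \<in> P \<longleftrightarrow> subgroup (fst p) G \<and> fst p \<subseteq> H \<and> snd p \<in> L (fst p)"
  by (cases p) (auto simp: pairs_def subgroups_of_def)

lemma P_D:
  assumes "p \<in> P"
  shows "subgroup (fst p) G" "fst p \<subseteq> H" "snd p \<in> L (fst p)" "finite (fst p)" "card (fst p) > 0"
proof -
  show 1: "subgroup (fst p) G" "fst p \<subseteq> H" "snd p \<in> L (fst p)"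
    using assms by (auto simp: mem_P_iff)
  show 2: "finite (fst p)" using 1(2) by (rule finite_subset_H)
  show "card (fst p) > 0"
    using 2 subgroup.one_closed[OF 1(1)] by (auto simp: card_gt_0_iff)
qed

subsection \<open>The action\<close>

lemma fst_pair_act [simp]: "fst (h \<bullet> p) = conj_set G h (fst p)"
  and snd_pair_act [simp]: "snd (h \<bullet> p) = act h (snd p)"
  by (simp_all add: conj_pair_def split: prod.split)

lemma conj_set_mono: "K \<subseteq> U \<Longrightarrow> conj_set G h K \<subseteq> conj_set G h U"
  unfolding subset_iff conj_set_mem by blast

lemma conj_set_image: "conj_set G h K = (\<lambda>k. h \<otimes> k \<otimes> inv h) ` K"
  by (auto simp: conj_set_mem)

lemma conj_set_mult:
  assumes "K \<subseteq> carrier G" "g \<in> carrier G" "h \<in> carrier G"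
  shows "conj_set G (g \<otimes> h) K = conj_set G g (conj_set G h K)"
proof -
  have "(g \<otimes> h) \<otimes> k \<otimes> inv (g \<otimes> h) = g \<otimes> (h \<otimes> k \<otimes> inv h) \<otimes> inv g" if "k \<in> K" for k
  proof -
    have "k \<in> carrier G" using that assms(1) by blast
    then show ?thesis using assms(2,3) by (simp add: inv_mult_group m_assoc)
  qed
  then show ?thesis unfolding conj_set_image image_image by (rule image_cong[OF refl])
qed

lemma conj_set_one:
  assumes "K \<subseteq> carrier G"
  shows "conj_set G \<one> K = K"
proof -
  have "\<one> \<otimes> k \<otimes> inv \<one> = k" if "k \<in> K" for k
  proof -
    have "k \<in> carrier G" using that assms by blast
    then show ?thesis by simp
  qed
  then show ?thesis unfolding conj_set_image by simp
qed

lemma conj_set_subgroup: "subgroup K G \<Longrightarrow> h \<in> carrier G \<Longrightarrow> subgroup (conj_set G h K) G"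
  unfolding conj_set_def using subgroup_conjugation_is_surj1[of "inv h" K] by simp

lemma conj_set_sub_H:
  assumes "K \<subseteq> H" "h \<in> H"
  shows "conj_set G h K \<subseteq> H"
  using assms unfolding subset_iff conj_set_mem by (metis H.m_closed H.m_inv_closed)

lemma conj_set_self:
  assumes "subgroup K G" "k \<in> K"
  shows "conj_set G k K = K"
proof -
  interpret K: subgroup K G by fact
  have 1: "conj_set G h K \<subseteq> K" if "h \<in> K" for h
    using that unfolding subset_iff conj_set_mem by (metis K.m_closed K.m_inv_closed)
  have "K = conj_set G (k \<otimes> inv k) K"
    using assms(2) conj_set_one[OF K.subset] by simp
  also have "\<dots> = conj_set G k (conj_set G (inv k) K)"
    using assms(2) by (intro conj_set_mult K.subset) auto
  also have "\<dots> \<subseteq> conj_set G k K"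
    using 1[of "inv k"] assms(2) by (intro conj_set_mono) auto
  finally show ?thesis using 1[OF assms(2)] by blast
qed

lemma act_mult: "g \<in> carrier G \<Longrightarrow> h \<in> carrier G \<Longrightarrow> act (g \<otimes> h) s = act g (act h s)"
  using composition_rule[of s g h] by simp

lemma act_one: "act \<one> s = s"
  using id_eq_one by (metis UNIV_I restrict_apply')

lemma pair_act_closed: "h \<in> H \<Longrightarrow> p \<in> P \<Longrightarrow> h \<bullet> p \<in> P"
  unfolding mem_P_iff
  using conj_image conj_set_subgroup conj_set_sub_H by auto

lemma pair_act_mult: "g \<in> H \<Longrightarrow> h \<in> H \<Longrightarrow> p \<in> P \<Longrightarrow> (g \<otimes> h) \<bullet> p = g \<bullet> h \<bullet> p"
  using subgroup.subset[OF P_D(1)] by (intro prod_eqI) (simp_all add: conj_set_mult act_mult)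

lemma pair_act_one: "p \<in> P \<Longrightarrow> \<one> \<bullet> p = p"
  using subgroup.subset[OF P_D(1)] by (intro prod_eqI) (simp_all add: conj_set_one act_one)

lemma pair_act_inv:
  assumes "h \<in> H" "p \<in> P"
  shows "inv h \<bullet> h \<bullet> p = p" "h \<bullet> inv h \<bullet> p = p"
  using assms pair_act_mult[of "inv h" h p] pair_act_mult[of h "inv h" p] pair_act_one by auto

lemma pair_act_self: "p \<in> P \<Longrightarrow> k \<in> fst p \<Longrightarrow> k \<bullet> p = p"
  using fixed[OF P_D(1) _ P_D(3)] by (intro prod_eqI) (simp_all add: conj_set_self P_D)

lemma act_le_iff: "h \<in> carrier G \<Longrightarrow> act h s \<le> act h t \<longleftrightarrow> s \<le> t"
  using act_mono[of h s t] act_mono[of "inv h" "act h s" "act h t"]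
  by (auto simp flip: act_mult simp: act_one)

lemma act_inv: "h \<in> carrier G \<Longrightarrow> act h (act (inv h) s) = s"
  by (simp flip: act_mult add: act_one)

lemma act_inf:
  assumes "h \<in> carrier G"
  shows "act h (inf s t) = inf (act h s) (act h t)"
proof (rule order_antisym)
  show "act h (inf s t) \<le> inf (act h s) (act h t)"
    using assms by (simp add: act_le_iff)
  let ?r = "act (inv h) (inf (act h s) (act h t))"
  have "act h ?r \<le> act h s" "act h ?r \<le> act h t" using assms by (simp_all add: act_inv)
  then have "?r \<le> inf s t" using assms by (simp add: act_le_iff)
  then have "act h ?r \<le> act h (inf s t)" using assms by (simp add: act_le_iff)
  then show "inf (act h s) (act h t) \<le> act h (inf s t)" using assms by (simp add: act_inv)
qed

lemma conj_set_Int: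
  assumes "K \<subseteq> carrier G" "U \<subseteq> carrier G" "h \<in> carrier G"
  shows "conj_set G h (K \<inter> U) = conj_set G h K \<inter> conj_set G h U"
proof -
  have "h \<otimes> k \<otimes> inv h = h \<otimes> u \<otimes> inv h \<Longrightarrow> k = u" if "k \<in> K" "u \<in> U" for k u
  proof -
    have "k \<in> carrier G" "u \<in> carrier G" using that assms by blast+
    then show "h \<otimes> k \<otimes> inv h = h \<otimes> u \<otimes> inv h \<Longrightarrow> k = u" using assms(3) by simp
  qed
  then show ?thesis unfolding set_eq_iff Int_iff conj_set_mem by blast
qed

lemma pair_act_mono: "h \<in> H \<Longrightarrow> p \<le> q \<Longrightarrow> h \<bullet> p \<le> h \<bullet> q"
  by (auto simp: less_eq_prod_def act_mono conj_set_mono)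

lemma pair_act_le_iff:
  assumes "h \<in> H" "p \<in> P" "q \<in> P"
  shows "h \<bullet> p \<le> h \<bullet> q \<longleftrightarrow> p \<le> q"
  using pair_act_mono[of h p q] pair_act_mono[of "inv h" "h \<bullet> p" "h \<bullet> q"] assms pair_act_inv by auto

lemma pair_act_le_move:
  assumes "h \<in> H" "p \<in> P" "q \<in> P"
  shows "p \<le> h \<bullet> q \<longleftrightarrow> inv h \<bullet> p \<le> q"
  using pair_act_le_iff[of h "inv h \<bullet> p" q] assms pair_act_inv pair_act_closed by auto

subsection \<open>Meets\<close>

abbreviation top_L where "top_L K \<equiv> Sup_fin (L K)"

lemma top_L_mem:
  assumes "subgroup K G"
  shows "top_L K \<in> L K"
proof -
  have "Sup_fin A \<in> L K" if "finite A" "A \<noteq> {}" "A \<subseteq> L K" for A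
    using that by (induction rule: finite_ne_induct) (auto simp: sup_closed[OF assms])
  then show ?thesis using nonempty[OF assms] by simp
qed

lemma le_top_L: "s \<in> L K \<Longrightarrow> s \<le> top_L K"
  by (rule Sup_fin.coboundedI) auto

lemma act_top_L:
  assumes "h \<in> carrier G" "subgroup K G"
  shows "act h (top_L K) = top_L (conj_set G h K)"
proof (rule order_antisym)
  note im = conj_image[OF assms(2,1)]
  show "act h (top_L K) \<le> top_L (conj_set G h K)"
    using im top_L_mem[OF assms(2)] by (intro le_top_L) blast
  have "top_L (conj_set G h K) \<in> act h ` L K"
    using top_L_mem[OF conj_set_subgroup[OF assms(2,1)]] im by simp
  then obtain s where "s \<in> L K" "top_L (conj_set G h K) = act h s" by blast
  then show "top_L (conj_set G h K) \<le> act h (top_L K)"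
    using assms le_top_L act_mono by auto
qed

text \<open>The restriction map \<open>s \<mapsto> s \<and> sup L V\<close>, recorded together with its target \<open>V\<close>.\<close>

definition cut :: "'g set \<Rightarrow> 'l \<Rightarrow> 'g set \<times> 'l" where
  "cut V s = (V, inf s (top_L V))"

lemma cut_mem:
  assumes "subgroup K G" "subgroup V G" "V \<subseteq> K" "V \<subseteq> H" "s \<in> L K"
  shows "cut V s \<in> P"
  using assms restriction by (auto simp: mem_P_iff cut_def)

text \<open>Truncating at \<open>top_L V\<close> does not change the lower bounds in \<open>P\<close>, since the tops grow with the
  subgroup.\<close>

lemma le_cut_iff:
  assumes "w \<in> P" "subgroup V G"
  shows "w \<le> cut V s \<longleftrightarrow> fst w \<subseteq> V \<and> snd w \<le> s"
proof -
  have "snd w \<le> top_L V" if "fst w \<subseteq> V"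
    using order_trans[OF le_top_L[OF P_D(3)[OF assms(1)]] top_mono[OF assms(2) P_D(1)[OF assms(1)] that]] .
  then show ?thesis by (auto simp: cut_def less_eq_prod_def)
qed

text \<open>The greatest lower bound in \<open>P\<close>. With \<open>q\<close> replaced by its translates it is also the pair that
  occurs in the product of two basis elements, which is what makes the marks multiplicative.\<close>

definition pair_meet :: "'g set \<times> 'l \<Rightarrow> 'g set \<times> 'l \<Rightarrow> 'g set \<times> 'l" where
  "pair_meet p q = cut (fst p \<inter> fst q) (inf (snd p) (snd q))"

lemma pair_meet_mem:
  assumes "p \<in> P" "q \<in> P"
  shows "pair_meet p q \<in> P"
proof -
  let ?V = "fst p \<inter> fst q"
  note p = P_D[OF assms(1)] and q = P_D[OF assms(2)]
  have V: "subgroup ?V G" using subgroups_Inter_pair p(1) q(1) by blast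
  have "inf (inf (snd p) (top_L ?V)) (inf (snd q) (top_L ?V)) \<in> L ?V"
    using p q V by (intro inf_closed restriction) auto
  also have "inf (inf (snd p) (top_L ?V)) (inf (snd q) (top_L ?V)) =
      inf (inf (snd p) (snd q)) (top_L ?V)"
    by (simp add: ac_simps)
  finally show ?thesis using V p by (auto simp: pair_meet_def cut_def mem_P_iff)
qed

lemma le_pair_meet_iff:
  assumes "w \<in> P" "p \<in> P" "q \<in> P"
  shows "w \<le> pair_meet p q \<longleftrightarrow> w \<le> p \<and> w \<le> q"
  using le_cut_iff[OF assms(1)] subgroups_Inter_pair P_D(1)[OF assms(2)] P_D(1)[OF assms(3)]
  by (auto simp: pair_meet_def less_eq_prod_def)

lemma pair_act_cut:
  assumes "h \<in> carrier G" "subgroup V G"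
  shows "h \<bullet> cut V s = cut (conj_set G h V) (act h s)"
  using assms by (simp add: cut_def conj_pair_def act_inf act_top_L)

lemma pair_act_meet:
  assumes "h \<in> H" "p \<in> P" "q \<in> P"
  shows "h \<bullet> pair_meet p q = pair_meet (h \<bullet> p) (h \<bullet> q)"
  using assms P_D(1)[OF assms(2)] P_D(1)[OF assms(3)]
  by (simp add: pair_meet_def pair_act_cut subgroups_Inter_pair act_inf conj_set_Int subgroup.subset)

end

section \<open>Linear forms on free modules\<close>

text \<open>Marks, the values of \<open>phi\<close> and the coefficients of \<open>rho\<close> are all linear extensions of
  functions on the basis.\<close>

definition lin_form :: "('b \<Rightarrow> 'c::comm_ring_1) \<Rightarrow> ('b \<Rightarrow>\<^sub>0 'c) \<Rightarrow> 'c" where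
  "lin_form F x = (\<Sum>b\<in>Poly_Mapping.keys x. Poly_Mapping.lookup x b * F b)"

lemma lin_form_superset:
  assumes "finite B" "Poly_Mapping.keys x \<subseteq> B"
  shows "lin_form F x = (\<Sum>b\<in>B. Poly_Mapping.lookup x b * F b)"
  unfolding lin_form_def
  by (rule sum.mono_neutral_left) (use assms in \<open>auto simp: in_keys_iff\<close>)

lemma lin_form_zero [simp]: "lin_form F 0 = 0"
  by (simp add: lin_form_def)

lemma lin_form_add: "lin_form F (x + y) = lin_form F x + lin_form F y"
proof -
  let ?B = "Poly_Mapping.keys x \<union> Poly_Mapping.keys y"
  have "lin_form F z = (\<Sum>b\<in>?B. Poly_Mapping.lookup z b * F b)" if "z \<in> {x, y, x + y}" for z
    by (rule lin_form_superset) (use that Poly_Mapping.keys_add[of x y] in auto)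
  then show ?thesis by (simp add: lookup_add distrib_right sum.distrib)
qed

lemma lin_form_sum: "lin_form F (sum f A) = (\<Sum>a\<in>A. lin_form F (f a))"
  by (induction A rule: infinite_finite_induct) (simp_all add: lin_form_add)

lemma lin_form_scale: "lin_form F (scale c x) = c * lin_form F x"
proof -
  have "Poly_Mapping.keys (scale c x) \<subseteq> Poly_Mapping.keys x" by (auto simp: in_keys_iff)
  then have "lin_form F (scale c x) = (\<Sum>b\<in>Poly_Mapping.keys x. Poly_Mapping.lookup (scale c x) b * F b)"
    by (intro lin_form_superset) simp_all
  then show ?thesis by (simp add: lin_form_def sum_distrib_left mult.assoc)
qed

lemma lin_form_diff: "lin_form F (x - y) = lin_form F x - lin_form F y"
  using lin_form_add[of F "x - y" y] by simp

lemma lin_form_single: "lin_form F (Poly_Mapping.single b c) = c * F b"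
  by (cases "c = 0") (simp_all add: lin_form_def)

lemma lin_form_lin_extend: "lin_form F (lin_extend f x) = lin_form (\<lambda>a. lin_form F (f a)) x"
  by (simp add: lin_extend_def lin_form_sum lin_form_scale lin_form_def[of _ x])

lemma lookup_lin_extend:
  "Poly_Mapping.lookup (lin_extend f x) b = lin_form (\<lambda>a. Poly_Mapping.lookup (f a) b) x"
  by (simp add: lin_extend_def lin_form_def lookup_sum)

lemma keys_lin_extend:
  assumes "\<And>a. a \<in> Poly_Mapping.keys x \<Longrightarrow> Poly_Mapping.keys (f a) \<subseteq> B"
  shows "Poly_Mapping.keys (lin_extend f x) \<subseteq> B"
proof
  fix b assume "b \<in> Poly_Mapping.keys (lin_extend f x)"
  then have "(\<Sum>a\<in>Poly_Mapping.keys x. Poly_Mapping.lookup x a * Poly_Mapping.lookup (f a) b) \<noteq> 0"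
    by (simp add: in_keys_iff lookup_lin_extend lin_form_def)
  then obtain a where "a \<in> Poly_Mapping.keys x" "Poly_Mapping.lookup (f a) b \<noteq> 0"
    by (metis (no_types, lifting) mult_zero_right sum.neutral)
  then show "b \<in> B" using assms[of a] by (auto simp: in_keys_iff)
qed

lemma lin_form_cong:
  assumes "\<And>b. b \<in> Poly_Mapping.keys x \<Longrightarrow> F b = F' b"
  shows "lin_form F x = lin_form F' x"
  unfolding lin_form_def using assms by simp

lemma lin_form_mult_left: "lin_form (\<lambda>b. c * F b) x = c * lin_form F x"
  by (simp add: lin_form_def sum_distrib_left mult.left_commute)

lemma lin_form_sum_form: "lin_form (\<lambda>b. \<Sum>i\<in>I. F i b) x = (\<Sum>i\<in>I. lin_form (F i) x)"
  unfolding lin_form_def sum_distrib_left by (rule sum.swap)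

text \<open>Bilinearity reduces multiplicativity of a form to the structure constants.\<close>

lemma lin_form_bilinear:
  assumes "\<And>a b. a \<in> Poly_Mapping.keys x \<Longrightarrow> b \<in> Poly_Mapping.keys y \<Longrightarrow>
      lin_form F (m a b) = F a * F b"
  shows "lin_form F (lin_extend (\<lambda>a. lin_extend (m a) y) x) = lin_form F x * lin_form F y"
proof -
  have "lin_form F (lin_extend (\<lambda>a. lin_extend (m a) y) x)
      = lin_form (\<lambda>a. lin_form (\<lambda>b. lin_form F (m a b)) y) x"
    by (simp add: lin_form_lin_extend)
  also have "\<dots> = lin_form (\<lambda>a. lin_form F y * F a) x"
  proof (rule lin_form_cong)
    fix a assume "a \<in> Poly_Mapping.keys x"
    then have "lin_form (\<lambda>b. lin_form F (m a b)) y = lin_form (\<lambda>b. F a * F b) y"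
      using assms by (intro lin_form_cong) auto
    then show "lin_form (\<lambda>b. lin_form F (m a b)) y = lin_form F y * F a"
      by (metis lin_form_mult_left mult.commute)
  qed
  finally show ?thesis by (metis lin_form_mult_left mult.commute)
qed

section \<open>Marks\<close>

context burnside_pairs
begin

lemma pair_act_stable: "h \<in> H \<Longrightarrow> q \<in> P \<Longrightarrow> k \<in> fst q \<Longrightarrow> (h \<otimes> k) \<bullet> q = h \<bullet> q"
  using P_D(2)[of q] by (simp add: pair_act_mult pair_act_self subsetD)

text \<open>The subgroup \<open>fst q\<close> fixes \<open>q\<close>, so \<open>h \<bullet> q\<close> depends only on the coset of \<open>h\<close>. Counts of cosets
  thus become counts of elements of \<open>H\<close>, in which translation by \<open>H\<close> is a change of variables.\<close>

lemma sum_cosets_pair: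
  fixes f :: "'g set \<times> 'l \<Rightarrow> 'c::semiring_1"
  assumes q: "q \<in> P"
  shows "(\<Sum>h | h \<in> H \<and> Q (h \<bullet> q). f (h \<bullet> q)) =
    of_nat (card (fst q)) * (\<Sum>D\<in>{h <# fst q |h. h \<in> H \<and> Q (h \<bullet> q)}. f ((SOME h. h \<in> D) \<bullet> q))"
proof -
  let ?A = "{h. h \<in> H \<and> Q (h \<bullet> q)}"
  have "sum (\<lambda>h. f (h \<bullet> q)) ?A =
      of_nat (card (fst q)) * (\<Sum>D\<in>{h <# fst q |h. h \<in> ?A}. f ((SOME h. h \<in> D) \<bullet> q))"
  proof (rule sum_left_cosets)
    show "subgroup (fst q) G" by (rule P_D(1)[OF q])
    show "finite ?A" using finite_H by simp
    show "?A \<subseteq> carrier G" by auto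
    show "a \<otimes> k \<in> ?A" if "a \<in> ?A" "k \<in> fst q" for a k
      using that pair_act_stable[OF _ q, of a k] P_D(2)[OF q] by auto
    show "f ((a \<otimes> k) \<bullet> q) = f (a \<bullet> q)" if "a \<in> ?A" "k \<in> fst q" for a k
      using that pair_act_stable[OF _ q, of a k] by simp
  qed
  then show ?thesis by simp
qed

lemma card_cosets_pair:
  assumes "q \<in> P"
  shows "card {h. h \<in> H \<and> Q (h \<bullet> q)} = card (fst q) * card {h <# fst q |h. h \<in> H \<and> Q (h \<bullet> q)}"
  using sum_cosets_pair[OF assms, where f = "\<lambda>_. 1 :: nat"] by simp

lemma bij_right_mult: "g \<in> H \<Longrightarrow> bij_betw (\<lambda>h. h \<otimes> g) H H"
  by (rule bij_betw_byWitness[where f' = "\<lambda>h. h \<otimes> inv g"]) (auto simp: m_assoc)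

lemma bij_left_mult: "g \<in> H \<Longrightarrow> bij_betw (\<lambda>h. g \<otimes> h) H H"
  by (rule bij_betw_byWitness[where f' = "\<lambda>h. inv g \<otimes> h"]) (auto simp: m_assoc[symmetric])

lemma card_reindex:
  assumes "bij_betw f A A"
  shows "card {h. h \<in> A \<and> Q (f h)} = card {h. h \<in> A \<and> Q h}"
proof -
  have "bij_betw f {h. h \<in> A \<and> Q (f h)} {h. h \<in> A \<and> Q h}"
  proof (rule bij_betw_imageI)
    show "inj_on f {h. h \<in> A \<and> Q (f h)}"
      using bij_betw_imp_inj_on[OF assms] by (rule inj_on_subset) auto
    show "f ` {h. h \<in> A \<and> Q (f h)} = {h. h \<in> A \<and> Q h}"
      using bij_betw_imp_surj_on[OF assms] by auto
  qed
  then show ?thesis by (rule bij_betw_same_card)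
qed

lemma card_orbit_right:
  assumes "g \<in> H" "q \<in> P"
  shows "card {h. h \<in> H \<and> Q (h \<bullet> g \<bullet> q)} = card {h. h \<in> H \<and> Q (h \<bullet> q)}"
proof -
  have "{h. h \<in> H \<and> Q (h \<bullet> g \<bullet> q)} = {h. h \<in> H \<and> Q ((h \<otimes> g) \<bullet> q)}"
    using pair_act_mult[OF _ assms] by auto
  then show ?thesis using card_reindex[OF bij_right_mult[OF assms(1)]] by simp
qed

lemma card_orbit_left:
  assumes "g \<in> H" "q \<in> P"
  shows "card {h. h \<in> H \<and> Q (g \<bullet> h \<bullet> q)} = card {h. h \<in> H \<and> Q (h \<bullet> q)}"
proof -
  have "{h. h \<in> H \<and> Q (g \<bullet> h \<bullet> q)} = {h. h \<in> H \<and> Q ((g \<otimes> h) \<bullet> q)}"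
    using pair_act_mult[OF assms(1) _ assms(2)] by auto
  then show ?thesis using card_reindex[OF bij_left_mult[OF assms(1)]] by simp
qed

lemma card_fst_act:
  assumes "h \<in> H" "q \<in> P"
  shows "card (fst (h \<bullet> q)) = card (fst q)"
proof -
  have sub: "fst q \<subseteq> carrier G" using subgroup.subset[OF P_D(1)[OF assms(2)]] .
  have "inj_on (\<lambda>k. h \<otimes> k \<otimes> inv h) (fst q)"
  proof (rule inj_onI)
    fix x y assume "x \<in> fst q" "y \<in> fst q" and eq: "h \<otimes> x \<otimes> inv h = h \<otimes> y \<otimes> inv h"
    then have "x \<in> carrier G" "y \<in> carrier G" using sub by blast+
    with eq show "x = y" using assms(1) by simp
  qed
  then show ?thesis by (simp add: conj_set_image card_image)
qed

text \<open>For \<open>p = (U, t)\<close> and \<open>q = (K, s)\<close>: the number of points of the labelled \<open>H\<close>-set \<open>(H/K)\<^sub>s\<close>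
  that are fixed by \<open>U\<close> and have a label above \<open>t\<close>.\<close>

definition mark :: "'g set \<times> 'l \<Rightarrow> 'g set \<times> 'l \<Rightarrow> nat" where
  "mark p q = card {h <# fst q |h. h \<in> H \<and> p \<le> h \<bullet> q}"

lemma mark_count: "q \<in> P \<Longrightarrow> card (fst q) * mark p q = card {h. h \<in> H \<and> p \<le> h \<bullet> q}"
  by (simp add: mark_def card_cosets_pair)

lemma mark_act_right:
  assumes "g \<in> H" "q \<in> P"
  shows "mark p (g \<bullet> q) = mark p q"
proof -
  have "card (fst q) * mark p (g \<bullet> q) = card (fst q) * mark p q"
    using mark_count[of "g \<bullet> q" p] mark_count[of q p] card_orbit_right[OF assms]
      card_fst_act[OF assms] pair_act_closed[OF assms] assms(2) by simp
  then show ?thesis using P_D(5)[OF assms(2)] by simp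
qed

text \<open>A pair \<open>(h, g)\<close> with \<open>w \<le> h \<bullet> p\<close> and \<open>w \<le> g \<bullet> q\<close> is written with \<open>g = h k\<close>; the two conditions
  then say that \<open>w\<close> lies below the translate by \<open>h\<close> of the meet of \<open>p\<close> and \<open>k \<bullet> q\<close>.\<close>

lemma mark_count_product:
  assumes w: "w \<in> P" and p: "p \<in> P" and q: "q \<in> P"
  shows "card {h. h \<in> H \<and> w \<le> h \<bullet> p} * card {h. h \<in> H \<and> w \<le> h \<bullet> q}
    = (\<Sum>k\<in>H. card {h. h \<in> H \<and> w \<le> h \<bullet> pair_meet p (k \<bullet> q)})"
proof -
  have count: "card {k. k \<in> H \<and> Q k} = (\<Sum>k\<in>H. if Q k then 1 else 0)" for Q
    by (rule card_as_sums) (auto simp: finite_H)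
  have "(\<Sum>k\<in>H. card {h. h \<in> H \<and> w \<le> h \<bullet> pair_meet p (k \<bullet> q)})
      = (\<Sum>h\<in>H. \<Sum>k\<in>H. if w \<le> h \<bullet> p \<and> w \<le> h \<bullet> k \<bullet> q then 1 else 0)"
    unfolding count
    by (subst sum.swap)
      (simp add: w p q pair_act_meet pair_act_closed le_pair_meet_iff)
  also have "\<dots> = (\<Sum>h\<in>H. if w \<le> h \<bullet> p then card {k. k \<in> H \<and> w \<le> h \<bullet> k \<bullet> q} else 0)"
    unfolding count by (intro sum.cong) auto
  also have "\<dots> = (\<Sum>h\<in>H. if w \<le> h \<bullet> p then card {k. k \<in> H \<and> w \<le> k \<bullet> q} else 0)"
    using card_orbit_left[OF _ q, where Q = "\<lambda>r. w \<le> r"] by (intro sum.cong) auto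
  also have "\<dots> = (\<Sum>h\<in>H. if w \<le> h \<bullet> p then 1 else 0) * card {k. k \<in> H \<and> w \<le> k \<bullet> q}"
    by (simp add: sum_distrib_right if_distrib[of "\<lambda>c. c * _"] cong: if_cong)
  finally show ?thesis unfolding count by simp
qed

lemma fst_pair_meet: "fst (pair_meet p q) = fst p \<inter> fst q"
  by (simp add: pair_meet_def cut_def)

text \<open>The summand of \<open>mark_count_product\<close> is constant on double cosets, and the size of a double
  coset (\<open>card_double_coset\<close>) converts counts of elements into counts of cosets.\<close>

lemma mark_product:
  assumes w: "w \<in> P" and p: "p \<in> P" and q: "q \<in> P"
  shows "mark w p * mark w q
    = (\<Sum>D\<in>double_cosets G (fst p) H (fst q). mark w (pair_meet p ((SOME h. h \<in> D) \<bullet> q)))"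
proof -
  let ?DC = "double_cosets G (fst p) H (fst q)"
  let ?r = "\<lambda>D. SOME h. h \<in> D"
  let ?c = "\<lambda>k. card {h. h \<in> H \<and> w \<le> h \<bullet> pair_meet p (k \<bullet> q)}"
  note pD = P_D[OF p] and qD = P_D[OF q]
  have const: "?c (a \<otimes> k \<otimes> b) = ?c k" if "a \<in> fst p" "k \<in> H" "b \<in> fst q" for a k b
  proof -
    have aH: "a \<in> H" using that(1) pD(2) by blast
    have "(a \<otimes> k \<otimes> b) \<bullet> q = a \<bullet> k \<bullet> q"
      using that aH q by (simp add: pair_act_stable pair_act_mult)
    then have "pair_meet p ((a \<otimes> k \<otimes> b) \<bullet> q) = a \<bullet> pair_meet p (k \<bullet> q)"
      using that aH p q pair_act_meet[of a p "k \<bullet> q"] pair_act_closed[of k q] pair_act_self[of p a]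
      by simp
    then show ?thesis
      using card_orbit_right[of a "pair_meet p (k \<bullet> q)"] aH p q that(2)
      by (simp add: pair_meet_mem pair_act_closed)
  qed
  note some_in_H = some_in_double_coset(2)[OF subgroup_H finite_H pD(1,2) qD(1,2)]
  note card_some = card_double_coset_some[OF subgroup_H finite_H pD(1,2) qD(1,2)]
  have "card (fst p) * card (fst q) * (mark w p * mark w q) = (\<Sum>k\<in>H. ?c k)"
    unfolding mark_count_product[OF w p q, symmetric] mark_count[OF p, symmetric]
      mark_count[OF q, symmetric] by (simp add: ac_simps)
  also have "\<dots> = (\<Sum>D\<in>?DC. card D * ?c (?r D))"
    using sum_double_cosets[OF subgroup_H finite_H pD(1,2) qD(1,2), where f = ?c, OF const] by simp
  also have "\<dots> = (\<Sum>D\<in>?DC. card (fst p) * card (fst q) * mark w (pair_meet p (?r D \<bullet> q)))"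
  proof (rule sum.cong[OF refl])
    fix D assume D: "D \<in> ?DC"
    have "?r D \<bullet> q \<in> P" using some_in_H[OF D] q by (simp add: pair_act_closed)
    then have c: "?c (?r D) = card (fst p \<inter> conj_set G (?r D) (fst q)) * mark w (pair_meet p (?r D \<bullet> q))"
      using mark_count[of "pair_meet p (?r D \<bullet> q)" w] pair_meet_mem[OF p] by (simp add: fst_pair_meet)
    then show "card D * ?c (?r D) = card (fst p) * card (fst q) * mark w (pair_meet p (?r D \<bullet> q))"
      using card_some[OF D] unfolding c by (simp only: mult.assoc[symmetric])
  qed
  finally show ?thesis using pD(5) qD(5) by (simp add: sum_distrib_left[symmetric])
qed

text \<open>A strictly monotone rank on \<open>P\<close> that is constant on \<open>H\<close>-orbits. It makes the matrix of marks
  triangular.\<close>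

definition height :: "'g set \<times> 'l \<Rightarrow> nat" where
  "height p = card (fst p) + card {t. t \<le> snd p}"

lemma height_act:
  assumes "h \<in> H" "p \<in> P"
  shows "height (h \<bullet> p) = height p"
proof -
  have h: "h \<in> carrier G" using assms by simp
  have "bij_betw (act h) {t. t \<le> snd p} {t. t \<le> act h (snd p)}"
    by (rule bij_betw_byWitness[where f' = "act (inv h)"])
      (use h act_le_iff[OF h] act_le_iff[of "inv h" _ "act h (snd p)"] in
        \<open>auto simp: act_one simp flip: act_mult\<close>)
  then show ?thesis
    using card_fst_act[OF assms] bij_betw_same_card by (fastforce simp: height_def)
qed

lemma height_le_imp_eq:
  assumes "p \<le> q" "height q \<le> height p" "q \<in> P"
  shows "p = q"
proof -
  have le: "fst p \<subseteq> fst q" "snd p \<le> snd q" using assms(1) by (auto simp: less_eq_prod_def)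
  have c1: "card (fst p) \<le> card (fst q)" using le(1) P_D(4)[OF assms(3)] by (rule card_mono[rotated])
  have c2: "card {t. t \<le> snd p} \<le> card {t. t \<le> snd q}"
    using le(2) by (intro card_mono) (auto intro: order_trans)
  have c: "card (fst p) = card (fst q)" "card {t. t \<le> snd p} = card {t. t \<le> snd q}"
    using c1 c2 assms(2) by (auto simp: height_def)
  have "fst p = fst q" using le(1) P_D(4)[OF assms(3)] c(1) by (intro card_subset_eq)
  moreover have "{t. t \<le> snd p} \<subseteq> {t. t \<le> snd q}" using order_trans[OF _ le(2)] by blast
  then have "{t. t \<le> snd p} = {t. t \<le> snd q}" using c(2) by (intro card_subset_eq) auto
  ultimately have "fst p = fst q" "snd q \<le> snd p" by auto
  then show ?thesis using le by (intro prod_eqI) auto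
qed

lemma mark_self_pos:
  assumes "p \<in> P"
  shows "mark p p > 0"
proof -
  have "\<one> \<in> {h. h \<in> H \<and> p \<le> h \<bullet> p}" using assms by (simp add: pair_act_one)
  then have "{h. h \<in> H \<and> p \<le> h \<bullet> p} \<noteq> {}" by blast
  then have "card {h. h \<in> H \<and> p \<le> h \<bullet> p} > 0"
    using finite_H by (simp only: card_gt_0_iff) simp
  then show ?thesis using mark_count[OF assms, of p] by (metis nat_0_less_mult_iff)
qed

lemma mark_nonzero:
  assumes "mark p q \<noteq> 0"
  shows "\<exists>h\<in>H. p \<le> h \<bullet> q"
proof (rule ccontr)
  assume "\<not> ?thesis"
  then have "{h <# fst q |h. h \<in> H \<and> p \<le> h \<bullet> q} = {}" by blast
  then show False using assms by (simp only: mark_def card.empty)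
qed

end

section \<open>The Burnside algebra embeds in its ghost ring\<close>

locale burnside_basis = burnside_pairs G act L H
  for G :: "('g, 'm) monoid_scheme" (structure)
    and act :: "'g \<Rightarrow> 'l \<Rightarrow> 'l::{finite, lattice}" and L :: "'g set \<Rightarrow> 'l set" and H :: "'g set" +
  fixes R :: "('g set \<times> 'l) set"
  assumes transversal_R: "transversal H (conj_pair G act) P R"
begin

abbreviation rep where "rep p \<equiv> orbit_rep H (conj_pair G act) R p"

lemma R_subset: "R \<subseteq> P"
  using transversal_R by (simp add: transversal_def)

lemma R_P: "p \<in> R \<Longrightarrow> p \<in> P"
  using R_subset by blast

lemma rep_props:
  assumes "p \<in> P"
  shows "rep p \<in> R" "\<exists>h\<in>H. h \<bullet> p = rep p"
proof -
  have "\<exists>!r. r \<in> R \<and> (\<exists>h\<in>H. h \<bullet> p = r)"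
    using transversal_R assms by (simp add: transversal_def)
  from theI'[OF this] show "rep p \<in> R" "\<exists>h\<in>H. h \<bullet> p = rep p"
    by (simp_all add: orbit_rep_def)
qed

lemma R_unique:
  assumes "p \<in> R" "q \<in> R" "h \<in> H" "p = h \<bullet> q"
  shows "p = q"
proof -
  have "\<exists>!r. r \<in> R \<and> (\<exists>h\<in>H. h \<bullet> q = r)"
    using transversal_R R_P[OF assms(2)] by (simp add: transversal_def)
  moreover have "\<exists>h\<in>H. h \<bullet> q = q" using pair_act_one[OF R_P[OF assms(2)]] H.one_closed by blast
  moreover have "\<exists>h\<in>H. h \<bullet> q = p" using assms(3,4) by blast
  ultimately show ?thesis using assms(1,2) by blast
qed

lemma rep_invariant:
  assumes "p \<in> P" "\<And>h q. h \<in> H \<Longrightarrow> q \<in> P \<Longrightarrow> f (h \<bullet> q) = f q"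
  shows "f (rep p) = f p"
  using rep_props[OF assms(1)] assms by metis

definition marks :: "('g set \<times> 'l \<Rightarrow>\<^sub>0 'c::comm_ring_1) \<Rightarrow> 'g set \<times> 'l \<Rightarrow> 'c" where
  "marks x w = lin_form (\<lambda>q. of_nat (mark w q)) x"

lemma marks_basis:
  assumes "p \<in> P"
  shows "marks (basis G act H R p) w = of_nat (mark w p)"
  using rep_invariant[OF assms, where f = "mark w"] mark_act_right
  by (simp add: marks_def basis_def lin_form_single)

lemma keys_basis: "p \<in> P \<Longrightarrow> Poly_Mapping.keys (basis G act H R p) \<subseteq> R"
  using rep_props by (simp add: basis_def)

lemma basis_mult_eq:
  "basis_mult G act L H R p q =
    (\<Sum>D\<in>double_cosets G (fst p) H (fst q). basis G act H R (pair_meet p ((SOME h. h \<in> D) \<bullet> q)))"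
  by (simp add: basis_mult_def pair_meet_def cut_def Let_def split: prod.split)

lemma marks_basis_mult:
  assumes "p \<in> P" "q \<in> P" "w \<in> P"
  shows "marks (basis_mult G act L H R p q) w = of_nat (mark w p) * of_nat (mark w q)"
proof -
  have "marks (basis_mult G act L H R p q) w =
      (\<Sum>D\<in>double_cosets G (fst p) H (fst q). marks (basis G act H R (pair_meet p ((SOME h. h \<in> D) \<bullet> q))) w)"
    by (simp add: basis_mult_eq marks_def lin_form_sum)
  also have "\<dots> = (\<Sum>D\<in>double_cosets G (fst p) H (fst q). of_nat (mark w (pair_meet p ((SOME h. h \<in> D) \<bullet> q))))"
    using assms some_in_double_coset(2)[OF subgroup_H finite_H P_D(1,2)[OF assms(1)] P_D(1,2)[OF assms(2)]]
    by (intro sum.cong refl marks_basis pair_meet_mem pair_act_closed)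
  also have "\<dots> = of_nat (mark w p * mark w q)"
    using mark_product[OF assms(3,1,2)] by simp
  finally show ?thesis by simp
qed

lemma keys_basis_mult:
  assumes "p \<in> P" "q \<in> P"
  shows "Poly_Mapping.keys (basis_mult G act L H R p q) \<subseteq> R"
proof -
  have "Poly_Mapping.keys (basis G act H R (pair_meet p ((SOME h. h \<in> D) \<bullet> q))) \<subseteq> R"
    if "D \<in> double_cosets G (fst p) H (fst q)" for D
    by (intro keys_basis pair_meet_mem pair_act_closed assms
        some_in_double_coset(2)[OF subgroup_H finite_H P_D(1,2)[OF assms(1)]
          P_D(1,2)[OF assms(2)] that])
  then show ?thesis
    unfolding basis_mult_eq using Poly_Mapping.keys_sum by fast
qed

lemma marks_mult:
  assumes "Poly_Mapping.keys x \<subseteq> R" "Poly_Mapping.keys y \<subseteq> R" "w \<in> P"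
  shows "marks (lin_extend (\<lambda>p. lin_extend (\<lambda>q. basis_mult G act L H R p q) y) x) w =
    marks x w * marks y w"
  unfolding marks_def
proof (rule lin_form_bilinear)
  fix p q assume "p \<in> Poly_Mapping.keys x" "q \<in> Poly_Mapping.keys y"
  then have "p \<in> P" "q \<in> P" using assms R_P by blast+
  from marks_basis_mult[OF this assms(3)]
  show "lin_form (\<lambda>q. of_nat (mark w q)) (basis_mult G act L H R p q) =
      of_nat (mark w p) * of_nat (mark w q)"
    by (simp add: marks_def)
qed

text \<open>If \<open>p\<close> has maximal height in the support of \<open>x\<close>, no other \<open>q\<close> of the support has a translate above
  \<open>p\<close>. Hence \<open>marks x p\<close> is a nonzero multiple of the coefficient of \<open>x\<close> at \<open>p\<close>.\<close>

lemma marks_zero_imp_zero: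
  fixes x :: "'g set \<times> 'l \<Rightarrow>\<^sub>0 'c::{idom, ring_char_0}"
  assumes keys: "Poly_Mapping.keys x \<subseteq> R" and zero: "\<And>w. w \<in> R \<Longrightarrow> marks x w = 0"
  shows "x = 0"
proof (rule ccontr)
  let ?K = "Poly_Mapping.keys x"
  assume "x \<noteq> 0"
  then have "?K \<noteq> {}" by simp
  then have "Max (height ` ?K) \<in> height ` ?K" by (intro Max_in) auto
  then obtain p where p: "p \<in> ?K" and pmax: "height p = Max (height ` ?K)" by auto
  have max: "height q \<le> height p" if "q \<in> ?K" for q
    using that pmax by simp
  have "mark p q = 0" if q: "q \<in> ?K - {p}" for q
  proof (rule ccontr)
    assume "mark p q \<noteq> 0"
    then obtain h where h: "h \<in> H" "p \<le> h \<bullet> q" using mark_nonzero by blast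
    have qP: "q \<in> P" using q keys R_P by blast
    have eq: "p = h \<bullet> q"
      using h qP max[of q] q height_act[OF h(1) qP] pair_act_closed[OF h(1) qP]
      by (intro height_le_imp_eq) auto
    have "p \<in> R" "q \<in> R" using p q keys by blast+
    from R_unique[OF this h(1) eq] show False using q by simp
  qed
  then have "marks x p = Poly_Mapping.lookup x p * of_nat (mark p p)"
    unfolding marks_def lin_form_def using p by (subst sum.remove[of _ p]) auto
  moreover have "marks x p = 0" using zero p keys by blast
  moreover have "mark p p > 0" using mark_self_pos R_P p keys by blast
  ultimately show False using p by (auto simp: in_keys_iff)
qed

lemma marks_eqI:
  fixes x y :: "'g set \<times> 'l \<Rightarrow>\<^sub>0 'c::{idom, ring_char_0}"
  assumes "Poly_Mapping.keys x \<subseteq> R" "Poly_Mapping.keys y \<subseteq> R"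
    and "\<And>w. w \<in> R \<Longrightarrow> marks x w = marks y w"
  shows "x = y"
proof -
  have "x - y = 0"
  proof (rule marks_zero_imp_zero)
    show "Poly_Mapping.keys (x - y) \<subseteq> R"
      using assms(1,2) Poly_Mapping.keys_diff[of x y] by blast
  qed (use assms(3) in \<open>simp add: marks_def lin_form_diff\<close>)
  then show ?thesis by simp
qed

definition burnside_mult :: "('g set \<times> 'l \<Rightarrow>\<^sub>0 'c::comm_ring_1) \<Rightarrow> _ \<Rightarrow> _" where
  "burnside_mult x y = lin_extend (\<lambda>p. lin_extend (\<lambda>q. basis_mult G act L H R p q) y) x"

lemma keys_burnside_mult:
  assumes "Poly_Mapping.keys x \<subseteq> R" "Poly_Mapping.keys y \<subseteq> R"
  shows "Poly_Mapping.keys (burnside_mult x y) \<subseteq> R"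
  unfolding burnside_mult_def using assms by (intro keys_lin_extend keys_basis_mult) (auto intro: R_P)

lemma top_pair: "(H, top_L H) \<in> P"
  by (simp add: mem_P_iff subgroup_H top_L_mem)

lemma le_top_pair:
  assumes "w \<in> P" "h \<in> H"
  shows "w \<le> h \<bullet> (H, top_L H)"
proof -
  have "h \<bullet> (H, top_L H) = (H, top_L H)"
    using assms(2) pair_act_self[OF top_pair] by simp
  moreover have "snd w \<le> top_L H"
    using order_trans[OF le_top_L top_mono] P_D[OF assms(1)] subgroup_H by blast
  ultimately show ?thesis using P_D(2)[OF assms(1)] by (simp add: less_eq_prod_def)
qed

lemma marks_one:
  assumes "w \<in> P"
  shows "marks (basis G act H R (H, top_L H)) w = 1"
proof -
  have "{h. h \<in> H \<and> w \<le> h \<bullet> (H, top_L H)} = H" using le_top_pair[OF assms] by blast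
  then have "card H * mark w (H, top_L H) = card H"
    using mark_count[OF top_pair, of w] by simp
  then have "mark w (H, top_L H) = 1" using P_D(5)[OF top_pair] by simp
  then show ?thesis by (simp add: marks_basis[OF top_pair])
qed

text \<open>The ring axioms are identities between marks, and elements are determined by their marks.\<close>

lemma ring_burnside_algebra:
  "ring (burnside_algebra G act L H R :: ('g set \<times> 'l \<Rightarrow>\<^sub>0 'c::{idom, ring_char_0}) ring)"
  (is "ring ?B")
proof -
  have sel: "carrier ?B = {x. Poly_Mapping.keys x \<subseteq> R}" "monoid.mult ?B = burnside_mult"
    "\<one>\<^bsub>?B\<^esub> = basis G act H R (H, top_L H)" "\<zero>\<^bsub>?B\<^esub> = 0" "ring.add ?B = (+)"
    by (simp_all add: burnside_algebra_def burnside_mult_def fun_eq_iff)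
  have keys_add: "Poly_Mapping.keys (x + y) \<subseteq> R"
    if "Poly_Mapping.keys x \<subseteq> R" "Poly_Mapping.keys y \<subseteq> R" for x y :: "'g set \<times> 'l \<Rightarrow>\<^sub>0 'c"
    using that Poly_Mapping.keys_add[of x y] by blast
  have mm: "marks (burnside_mult x y) w = marks x w * marks y w"
    if "Poly_Mapping.keys x \<subseteq> R" "Poly_Mapping.keys y \<subseteq> R" "w \<in> R" for x y :: "'g set \<times> 'l \<Rightarrow>\<^sub>0 'c" and w
    unfolding burnside_mult_def using marks_mult that R_P by blast
  have ma: "marks (x + y) w = marks x w + marks y w" for x y :: "'g set \<times> 'l \<Rightarrow>\<^sub>0 'c" and w
    by (simp add: marks_def lin_form_add)
  have m1: "marks (basis G act H R (H, top_L H)) w = (1 :: 'c)" if "w \<in> R" for w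
    using marks_one that R_P by blast
  note [simp] = sel mm ma m1 keys_burnside_mult keys_basis[OF top_pair] keys_add
  show ?thesis
  proof (rule ringI)
    show "abelian_group ?B"
    proof (rule abelian_groupI)
      show "\<exists>y\<in>carrier ?B. y \<oplus>\<^bsub>?B\<^esub> x = \<zero>\<^bsub>?B\<^esub>" if "x \<in> carrier ?B" for x
        by (rule bexI[of _ "- x"]) (use that in \<open>auto simp: Poly_Mapping.keys_minus\<close>)
    qed (auto simp: ac_simps)
    show "monoid ?B"
      by (rule monoidI) (simp_all, (rule marks_eqI; simp add: ac_simps)+)
  qed (simp_all, (rule marks_eqI; simp add: algebra_simps)+)
qed

end

section \<open>The maps between the ghost rings\<close>

context burnside_pairs
begin

text \<open>The translates counted by \<open>phi\<close>: those above \<open>p\<close> in the subgroup component whose restriction to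
  \<open>fst p\<close> is \<open>snd p\<close>.\<close>

definition cuts_to :: "'g set \<times> 'l \<Rightarrow> 'g set \<times> 'l \<Rightarrow> bool" where
  "cuts_to r p \<longleftrightarrow> fst p \<subseteq> fst r \<and> cut (fst p) (snd r) = p"

definition exact_mark :: "'g set \<times> 'l \<Rightarrow> 'g set \<times> 'l \<Rightarrow> nat" where
  "exact_mark p q = card {h <# fst q |h. h \<in> H \<and> cuts_to (h \<bullet> q) p}"

lemma exact_mark_count:
  "q \<in> P \<Longrightarrow> card (fst q) * exact_mark p q = card {h. h \<in> H \<and> cuts_to (h \<bullet> q) p}"
  unfolding exact_mark_def
  by (rule card_cosets_pair[where Q = "\<lambda>r. cuts_to r p", symmetric])

lemma cuts_to_iff: "cuts_to r p \<longleftrightarrow> fst p \<subseteq> fst r \<and> snd p = inf (snd r) (top_L (fst p))"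
  by (cases p) (auto simp: cuts_to_def cut_def)

lemma cuts_to_mem:
  assumes "r \<in> P" "subgroup (fst p) G" "cuts_to r p"
  shows "p \<in> P"
proof -
  have "fst p \<subseteq> fst r" "cut (fst p) (snd r) = p" using assms(3) by (simp_all add: cuts_to_def)
  then show ?thesis
    using cut_mem[OF P_D(1)[OF assms(1)] assms(2) _ _ P_D(3)[OF assms(1)]] P_D(2)[OF assms(1)]
    by (metis order_trans)
qed

lemma cuts_to_act:
  assumes h: "h \<in> H" and p: "subgroup (fst p) G" and r: "r \<in> P" and c: "cuts_to r p"
  shows "cuts_to (h \<bullet> r) (h \<bullet> p)"
proof -
  have "cut (conj_set G h (fst p)) (act h (snd r)) = h \<bullet> cut (fst p) (snd r)"
    using h p by (simp add: pair_act_cut)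
  then show ?thesis using c by (simp add: cuts_to_def conj_set_mono)
qed

lemma cuts_to_act_iff:
  assumes h: "h \<in> H" and p: "subgroup (fst p) G" and r: "r \<in> P"
  shows "cuts_to (h \<bullet> r) (h \<bullet> p) \<longleftrightarrow> cuts_to r p"
proof
  assume c: "cuts_to (h \<bullet> r) (h \<bullet> p)"
  have "h \<bullet> p \<in> P"
    using cuts_to_mem[OF _ _ c] pair_act_closed[OF h r] conj_set_subgroup[OF p] h by simp
  then have "inv h \<bullet> h \<bullet> p \<in> P" using h by (simp add: pair_act_closed)
  moreover have "inv h \<bullet> h \<bullet> p = p"
    using h subgroup.subset[OF p]
    by (intro prod_eqI) (simp_all add: conj_set_one act_one flip: conj_set_mult act_mult)
  ultimately show "cuts_to r p"
    using cuts_to_act[of "inv h" "h \<bullet> p" "h \<bullet> r"] c h r p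
    by (simp add: pair_act_inv pair_act_closed conj_set_subgroup)
qed (rule cuts_to_act[OF assms])

lemma exact_mark_act:
  assumes g: "g \<in> H" and p: "subgroup (fst p) G" and q: "q \<in> P"
  shows "exact_mark (g \<bullet> p) q = exact_mark p q"
proof -
  have "{h. h \<in> H \<and> cuts_to (g \<bullet> h \<bullet> q) (g \<bullet> p)} = {h. h \<in> H \<and> cuts_to (h \<bullet> q) p}"
    using cuts_to_act_iff[OF g p] pair_act_closed[OF _ q] by blast
  then have "card (fst q) * exact_mark (g \<bullet> p) q = card (fst q) * exact_mark p q"
    using card_orbit_left[OF g q, where Q = "\<lambda>r. cuts_to r (g \<bullet> p)"] exact_mark_count[OF q]
    by simp
  then show ?thesis using P_D(5)[OF q] by simp
qed

text \<open>A pair with subgroup component above \<open>fst p\<close> cuts to exactly one pair \<open>(fst p, s)\<close>, and it lies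
  above \<open>p\<close> iff \<open>snd p \<le> s\<close>. Hence summing over these \<open>s\<close> turns the equality in \<open>exact_mark\<close> into
  the inequality in \<open>mark\<close>.\<close>

lemma sum_exact_mark:
  assumes p: "p \<in> P" and q: "q \<in> P"
  shows "(\<Sum>s | s \<in> L (fst p) \<and> snd p \<le> s. exact_mark (fst p, s) q) = mark p q"
proof -
  let ?U = "fst p"
  let ?S = "{s. s \<in> L ?U \<and> snd p \<le> s}"
  have count: "card {k. k \<in> H \<and> Q k} = (\<Sum>k\<in>H. if Q k then 1 else 0)" for Q
    by (rule card_as_sums) (auto simp: finite_H)
  have "card (fst q) * (\<Sum>s\<in>?S. exact_mark (?U, s) q) = (\<Sum>s\<in>?S. card {h. h \<in> H \<and> cuts_to (h \<bullet> q) (?U, s)})"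
    by (simp only: sum_distrib_left exact_mark_count[OF q])
  also have "\<dots> = (\<Sum>h\<in>H. \<Sum>s\<in>?S. if cuts_to (h \<bullet> q) (?U, s) then 1 else 0)"
    unfolding count by (rule sum.swap)
  also have "\<dots> = (\<Sum>h\<in>H. if p \<le> h \<bullet> q then 1 else 0)"
  proof (rule sum.cong[OF refl])
    fix h assume h: "h \<in> H"
    define r where "r = h \<bullet> q"
    have r: "r \<in> P" using h q by (simp add: r_def pair_act_closed)
    let ?c = "snd (cut ?U (snd r))"
    show "(\<Sum>s\<in>?S. if cuts_to (h \<bullet> q) (?U, s) then 1 else 0) = (if p \<le> h \<bullet> q then 1 else 0 :: nat)"
    proof (cases "?U \<subseteq> fst r")
      case True
      have "cut ?U (snd r) \<in> P"
        using cut_mem[OF P_D(1)[OF r] P_D(1)[OF p] True P_D(2)[OF p] P_D(3)[OF r]] .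
      then have "?c \<in> L ?U" using P_D(3) by (fastforce simp: cut_def)
      moreover have "snd p \<le> ?c \<longleftrightarrow> p \<le> r"
        using le_cut_iff[OF p P_D(1)[OF p], of "snd r"] True by (simp add: cut_def less_eq_prod_def)
      ultimately have "?c \<in> ?S \<longleftrightarrow> p \<le> r" by simp
      moreover have "cuts_to r (?U, s) \<longleftrightarrow> ?c = s" for s
        using True by (auto simp: cuts_to_def cut_def)
      ultimately show ?thesis unfolding r_def[symmetric] by (simp add: sum.delta)
    next
      case False
      then show ?thesis unfolding r_def[symmetric] by (simp add: cuts_to_def less_eq_prod_def)
    qed
  qed
  also have "\<dots> = card (fst q) * mark p q" by (simp add: mark_count[OF q] count)
  finally show ?thesis using P_D(5)[OF q] by simp
qed

text \<open>The coefficients of the mark homomorphism are the entries of \<open>phi\<close>; this is the reason for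
  \<open>\<alpha> \<circ> \<phi> = \<zeta> \<circ> \<rho>\<close>.\<close>

lemma lookup_coset_sum:
  assumes q: "q \<in> P"
  shows "Poly_Mapping.lookup (\<Sum>D\<in>{h <# fst q |h. h \<in> H \<and> U \<subseteq> conj_set G h (fst q)}.
      Poly_Mapping.single (inf (act (SOME h. h \<in> D) (snd q)) (top_L U)) (1 :: int)) s
    = of_nat (exact_mark (U, s) q)" (is "Poly_Mapping.lookup (sum _ ?D) s = _")
proof -
  let ?f = "\<lambda>r. if s = inf (snd r) (top_L U) then 1 else 0 :: int"
  have "int (card (fst q)) * (\<Sum>D\<in>?D. ?f ((SOME h. h \<in> D) \<bullet> q))
      = (\<Sum>h | h \<in> H \<and> U \<subseteq> fst (h \<bullet> q). ?f (h \<bullet> q))"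
    using sum_cosets_pair[OF q, where f = ?f and Q = "\<lambda>r. U \<subseteq> fst r"] by simp
  also have "\<dots> = (\<Sum>h | h \<in> H \<and> cuts_to (h \<bullet> q) (U, s). 1)"
    by (rule sum.mono_neutral_cong_right) (auto simp: finite_H cuts_to_iff)
  also have "\<dots> = int (card (fst q)) * int (exact_mark (U, s) q)"
    by (simp flip: exact_mark_count[OF q])
  finally have "(\<Sum>D\<in>?D. ?f ((SOME h. h \<in> D) \<bullet> q)) = int (exact_mark (U, s) q)"
    using P_D(5)[OF q] by simp
  then show ?thesis by (simp add: lookup_sum lookup_single when_def)
qed

end

lemma ring_Omega_tilde: "ring (Omega_tilde R)"
proof (rule ringI)
  have sel: "carrier (Omega_tilde R) = (\<Pi>\<^sub>E i\<in>R. UNIV)"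
    "monoid.mult (Omega_tilde R) = (\<lambda>x y. \<lambda>i\<in>R. x i * y i)"
    "\<one>\<^bsub>Omega_tilde R\<^esub> = (\<lambda>i\<in>R. 1)" "\<zero>\<^bsub>Omega_tilde R\<^esub> = (\<lambda>i\<in>R. 0)"
    "ring.add (Omega_tilde R) = (\<lambda>x y. \<lambda>i\<in>R. x i + y i)"
    by (simp_all add: Omega_tilde_def product_ring_def)
  note [simp] = sel
  show "abelian_group (Omega_tilde R)"
  proof (rule abelian_groupI)
    show "\<exists>y\<in>carrier (Omega_tilde R). y \<oplus>\<^bsub>Omega_tilde R\<^esub> x = \<zero>\<^bsub>Omega_tilde R\<^esub>"
      if "x \<in> carrier (Omega_tilde R)" for x
      by (rule bexI[of _ "\<lambda>i\<in>R. - x i"]) (auto simp: restrict_def fun_eq_iff)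
  qed (auto simp: fun_eq_iff PiE_def extensional_def restrict_def algebra_simps)
  show "monoid (Omega_tilde R)"
    by (rule monoidI) (auto simp: fun_eq_iff PiE_def extensional_def restrict_def algebra_simps)
qed (auto simp: Omega_tilde_def product_ring_def fun_eq_iff restrict_def algebra_simps)

context burnside_basis
begin

lemma phi_eq:
  assumes "p \<in> R"
  shows "phi G act L H R x p = lin_form (\<lambda>q. int (exact_mark p q)) x"
proof -
  have "phi G act L H R x p = (\<Sum>q\<in>Poly_Mapping.keys x. Poly_Mapping.lookup x q * int (exact_mark p q))"
    using assms by (simp add: phi_def exact_mark_def cuts_to_iff case_prod_beta)
  then show ?thesis by (simp add: lin_form_def)
qed

lemma alpha_phi_eq:
  assumes x: "Poly_Mapping.keys x \<subseteq> R" and p: "p \<in> R"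
  shows "alpha G act L H R (phi G act L H R x) p =
    (\<Sum>s | s \<in> L (fst p) \<and> snd p \<le> s. lin_form (\<lambda>q. int (exact_mark (fst p, s) q)) x)"
proof -
  have "phi G act L H R x (rep (fst p, s)) = lin_form (\<lambda>q. int (exact_mark (fst p, s) q)) x"
    if "s \<in> L (fst p)" for s
  proof -
    have sP: "(fst p, s) \<in> P" using P_D[OF R_P[OF p]] that by (simp add: mem_P_iff)
    have "exact_mark (rep (fst p, s)) q = exact_mark (fst p, s) q" if "q \<in> P" for q
      using exact_mark_act[OF _ P_D(1) that] by (rule rep_invariant[OF sP])
    then show ?thesis
      unfolding phi_eq[OF rep_props(1)[OF sP]] using x R_P by (intro lin_form_cong) auto
  qed
  then show ?thesis using p by (simp add: alpha_def case_prod_beta)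
qed

lemma alpha_phi_eq_marks:
  assumes x: "Poly_Mapping.keys x \<subseteq> R" and p: "p \<in> R"
  shows "alpha G act L H R (phi G act L H R x) p = marks x p"
proof -
  have pP: "p \<in> P" using R_P p .
  let ?S = "{s. s \<in> L (fst p) \<and> snd p \<le> s}"
  have "alpha G act L H R (phi G act L H R x) p =
      (\<Sum>s\<in>?S. lin_form (\<lambda>q. int (exact_mark (fst p, s) q)) x)"
    by (rule alpha_phi_eq[OF x p])
  also have "\<dots> = lin_form (\<lambda>q. \<Sum>s\<in>?S. int (exact_mark (fst p, s) q)) x"
    by (rule lin_form_sum_form[symmetric])
  also have "\<dots> = marks x p"
    unfolding marks_def
  proof (rule lin_form_cong)
    fix q assume "q \<in> Poly_Mapping.keys x"
    then have "q \<in> P" using x R_P by blast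
    from sum_exact_mark[OF pP this]
    show "(\<Sum>s\<in>?S. int (exact_mark (fst p, s) q)) = of_nat (mark p q)"
      by (simp flip: of_nat_sum)
  qed
  finally show ?thesis .
qed

lemma lookup_rho:
  assumes x: "Poly_Mapping.keys x \<subseteq> R" and U: "U \<in> subgroups_of G H"
  shows "Poly_Mapping.lookup (rho G act L H x U) s = lin_form (\<lambda>q. int (exact_mark (U, s) q)) x"
proof -
  have "Poly_Mapping.lookup (rho G act L H x U) s =
    lin_form (\<lambda>q. Poly_Mapping.lookup (\<Sum>D\<in>{h <# fst q |h. h \<in> H \<and> U \<subseteq> conj_set G h (fst q)}.
      Poly_Mapping.single (inf (act (SOME h. h \<in> D) (snd q)) (top_L U)) (1 :: int)) s) x"
    using U by (simp add: rho_def lookup_lin_extend case_prod_beta)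
  also have "\<dots> = lin_form (\<lambda>q. int (exact_mark (U, s) q)) x"
    using x R_P lookup_coset_sum by (intro lin_form_cong) auto
  finally show ?thesis .
qed

lemma zeta_rho_eq:
  assumes x: "Poly_Mapping.keys x \<subseteq> R" and p: "p \<in> R"
  shows "zeta L R (rho G act L H x) p = alpha G act L H R (phi G act L H R x) p"
proof -
  have "fst p \<in> subgroups_of G H" using P_D[OF R_P[OF p]] by (simp add: subgroups_of_def)
  then show ?thesis
    unfolding alpha_phi_eq[OF x p] using p lookup_rho[OF x]
    by (simp add: zeta_def case_prod_beta)
qed

text \<open>Equivariance is checked coefficientwise, where it is the invariance of \<open>exact_mark\<close> under the
  action on its first argument.\<close>

lemma rho_Mho:
  assumes x: "Poly_Mapping.keys x \<subseteq> R"
  shows "rho G act L H x \<in> carrier (Mho G act L H)"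
proof -
  let ?r = "rho G act L H x"
  have keys: "Poly_Mapping.keys (?r U) \<subseteq> L U" if U: "U \<in> subgroups_of G H" for U
  proof
    fix s assume "s \<in> Poly_Mapping.keys (?r U)"
    then have "lin_form (\<lambda>q. int (exact_mark (U, s) q)) x \<noteq> 0"
      by (simp add: in_keys_iff lookup_rho[OF x U])
    then obtain q where q: "q \<in> Poly_Mapping.keys x" "exact_mark (U, s) q \<noteq> 0"
      unfolding lin_form_def by (metis (no_types, lifting) mult_zero_right of_nat_0 sum.neutral)
    have qP: "q \<in> P" using q(1) x R_P by blast
    have "{h <# fst q |h. h \<in> H \<and> cuts_to (h \<bullet> q) (U, s)} \<noteq> {}"
      using q(2) unfolding exact_mark_def by (metis (no_types, lifting) card.empty)
    then obtain h where h: "h \<in> H" "cuts_to (h \<bullet> q) (U, s)" by blast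
    have "(U, s) \<in> P"
      using cuts_to_mem[OF pair_act_closed[OF h(1) qP] _ h(2)] U by (simp add: subgroups_of_def)
    then show "s \<in> L U" by (simp add: mem_P_iff)
  qed
  have equiv: "?r (conj_set G h U) = lin_extend (\<lambda>s. Poly_Mapping.single (act h s) 1) (?r U)"
    if h: "h \<in> H" and U: "U \<in> subgroups_of G H" for h U
  proof (rule poly_mapping_eqI)
    fix k
    have sub: "subgroup U G" "U \<subseteq> H" using U by (auto simp: subgroups_of_def)
    have hU: "conj_set G h U \<in> subgroups_of G H"
      using sub h by (simp add: subgroups_of_def conj_set_subgroup conj_set_sub_H)
    let ?k = "act (inv h) k"
    have k: "act h ?k = k" using h by (simp add: act_inv)
    have act_eq: "k = act h s \<longleftrightarrow> s = ?k" for s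
      using h act_inv[of "inv h" s] k by auto
    have "Poly_Mapping.lookup (lin_extend (\<lambda>s. Poly_Mapping.single (act h s) 1) (?r U)) k
        = lin_form (\<lambda>s. if s = ?k then 1 else 0) (?r U)"
      by (simp add: lookup_lin_extend lookup_single when_def eq_commute[of _ k] act_eq)
    also have "\<dots> = (\<Sum>s\<in>UNIV. Poly_Mapping.lookup (?r U) s * (if s = ?k then 1 else 0))"
      by (rule lin_form_superset) auto
    also have "\<dots> = Poly_Mapping.lookup (?r U) ?k"
      by (simp add: if_distrib[of "\<lambda>c. _ * c"] sum.delta cong: if_cong)
    also have "\<dots> = lin_form (\<lambda>q. int (exact_mark (U, ?k) q)) x"
      by (rule lookup_rho[OF x U])
    also have "\<dots> = lin_form (\<lambda>q. int (exact_mark (conj_set G h U, k) q)) x"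
    proof (rule lin_form_cong)
      fix q assume "q \<in> Poly_Mapping.keys x"
      then have "q \<in> P" using x R_P by blast
      moreover have "h \<bullet> (U, ?k) = (conj_set G h U, k)" by (simp add: conj_pair_def k)
      ultimately show "int (exact_mark (U, ?k) q) = int (exact_mark (conj_set G h U, k) q)"
        using exact_mark_act[OF h, of "(U, ?k)" q] sub by simp
    qed
    finally show "Poly_Mapping.lookup (?r (conj_set G h U)) k =
        Poly_Mapping.lookup (lin_extend (\<lambda>s. Poly_Mapping.single (act h s) 1) (?r U)) k"
      by (simp add: lookup_rho[OF x hU])
  qed
  have "?r \<in> (\<Pi>\<^sub>E U\<in>subgroups_of G H. {y. Poly_Mapping.keys y \<subseteq> L U})"
    using keys by (auto simp: PiE_def Pi_def) (simp add: rho_def)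
  with equiv show ?thesis
    by (auto simp: Mho_def Let_def product_ring_def meet_monoid_ring_def)
qed

lemma ring_hom_marks:
  "ring_hom_ring (Omega G act L H R) (Omega_tilde R) (alpha G act L H R \<circ> phi G act L H R)"
proof (rule ring_hom_ringI2)
  have eq: "(alpha G act L H R \<circ> phi G act L H R) x = (\<lambda>p\<in>R. marks x p)"
    if "Poly_Mapping.keys x \<subseteq> R" for x
    using alpha_phi_eq_marks[OF that] by (auto simp: fun_eq_iff alpha_def)
  show "ring (Omega G act L H R)" unfolding Omega_def by (rule ring_burnside_algebra)
  show "ring (Omega_tilde R)" by (rule ring_Omega_tilde)
  show "alpha G act L H R \<circ> phi G act L H R \<in> ring_hom (Omega G act L H R) (Omega_tilde R)"
  proof (rule ring_hom_memI)
    fix x y assume x: "x \<in> carrier (Omega G act L H R)" and y: "y \<in> carrier (Omega G act L H R)"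
    then have k: "Poly_Mapping.keys x \<subseteq> R" "Poly_Mapping.keys y \<subseteq> R"
      by (simp_all add: Omega_def burnside_algebra_def)
    show "(alpha G act L H R \<circ> phi G act L H R) x \<in> carrier (Omega_tilde R)"
      unfolding eq[OF k(1)] by (simp add: Omega_tilde_def product_ring_def)
    have "x \<otimes>\<^bsub>Omega G act L H R\<^esub> y = burnside_mult x y"
      by (simp add: Omega_def burnside_algebra_def burnside_mult_def)
    then show "(alpha G act L H R \<circ> phi G act L H R) (x \<otimes>\<^bsub>Omega G act L H R\<^esub> y)
      = (alpha G act L H R \<circ> phi G act L H R) x \<otimes>\<^bsub>Omega_tilde R\<^esub> (alpha G act L H R \<circ> phi G act L H R) y"
      unfolding eq[OF k(1)] eq[OF k(2)]
      using marks_mult[OF k R_P] eq[OF keys_burnside_mult[OF k]]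
      by (simp add: Omega_tilde_def product_ring_def fun_eq_iff burnside_mult_def)
    have "Poly_Mapping.keys (x + y) \<subseteq> R" using k Poly_Mapping.keys_add[of x y] by blast
    from eq[OF this]
    show "(alpha G act L H R \<circ> phi G act L H R) (x \<oplus>\<^bsub>Omega G act L H R\<^esub> y)
      = (alpha G act L H R \<circ> phi G act L H R) x \<oplus>\<^bsub>Omega_tilde R\<^esub> (alpha G act L H R \<circ> phi G act L H R) y"
      unfolding eq[OF k(1)] eq[OF k(2)]
      by (simp add: Omega_def burnside_algebra_def Omega_tilde_def product_ring_def fun_eq_iff
          marks_def lin_form_add)
  next
    show "(alpha G act L H R \<circ> phi G act L H R) \<one>\<^bsub>Omega G act L H R\<^esub> = \<one>\<^bsub>Omega_tilde R\<^esub>"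
      using eq[OF keys_basis[OF top_pair]]
      by (simp add: marks_one R_P Omega_def burnside_algebra_def Omega_tilde_def product_ring_def fun_eq_iff)
  qed
qed

lemma inj_alpha_phi:
  "inj_on (alpha G act L H R \<circ> phi G act L H R) (carrier (Omega G act L H R))"
proof (rule inj_onI)
  fix x y assume "x \<in> carrier (Omega G act L H R)" "y \<in> carrier (Omega G act L H R)"
    and eq: "(alpha G act L H R \<circ> phi G act L H R) x = (alpha G act L H R \<circ> phi G act L H R) y"
  then have k: "Poly_Mapping.keys x \<subseteq> R" "Poly_Mapping.keys y \<subseteq> R"
    by (simp_all add: Omega_def burnside_algebra_def)
  from eq have "marks x w = marks y w" if "w \<in> R" for w
    using alpha_phi_eq_marks[OF k(1) that] alpha_phi_eq_marks[OF k(2) that] by simp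
  then show "x = y" by (rule marks_eqI[OF k])
qed

end

section \<open>Primitive idempotents\<close>

context burnside_basis
begin

lemma subgroups_of_carrier: "subgroups_of G (carrier G) = {K. subgroup K G}"
  using subgroup.subset by (auto simp: subgroups_of_def)

lemma finite_subgroups_of: "finite (subgroups_of G K)"
proof -
  have "subgroups_of G K \<subseteq> Pow (carrier G)"
    using subgroup.subset by (auto simp: subgroups_of_def)
  then show ?thesis by (rule finite_subset) (simp add: finite_carrier)
qed

text \<open>For \<open>fst v \<subseteq> fst p\<close> the double sum factors into a Moebius sum over the subgroups between \<open>fst v\<close>
  and \<open>fst p\<close> and one over the elements of \<open>L (fst p)\<close> between \<open>snd v\<close> and \<open>snd p\<close>.\<close>

lemma sum_moebius_pairs:
  assumes p: "p \<in> P" and v: "v \<in> P"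
  shows "(\<Sum>t | t \<in> L (fst p) \<and> t \<le> snd p. moebius (L (fst p)) t (snd p) *
      (\<Sum>U\<in>subgroups_of G (fst p). moebius (subgroups_of G (carrier G)) U (fst p) *
        (if fst v \<subseteq> U \<and> snd v \<le> t then 1 else 0))) = (if v = p then 1 else 0)"
proof -
  let ?K = "fst p" and ?S = "subgroups_of G (carrier G)"
  let ?T = "{t. t \<in> L ?K \<and> t \<le> snd p}"
  note pD = P_D[OF p] and vD = P_D[OF v]
  have "(\<Sum>U\<in>subgroups_of G ?K. moebius ?S U ?K * (if fst v \<subseteq> U then 1 else 0))
      = (\<Sum>U | U \<in> ?S \<and> fst v \<le> U \<and> U \<le> ?K. moebius ?S U ?K)"
    using finite_subgroups_of[of ?K]
    by (intro sum.mono_neutral_cong_right) (auto simp: subgroups_of_def dest: subgroup.subset)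
  also have "\<dots> = (if fst v = ?K then 1 else 0)"
  proof (cases "fst v \<subseteq> ?K")
    case True
    then show ?thesis
      using sum_moebius_left[OF finite_subgroups_of, of "fst v" "carrier G" ?K] pD(1) vD(1)
      by (simp add: subgroups_of_carrier)
  next
    case False
    then have "{U. U \<in> ?S \<and> fst v \<le> U \<and> U \<le> ?K} = {}" by auto
    with False show ?thesis by (simp only: sum.empty) auto
  qed
  finally have groups: "(\<Sum>U\<in>subgroups_of G ?K. moebius ?S U ?K * (if fst v \<subseteq> U then 1 else 0))
      = (if fst v = ?K then 1 else 0)" .
  have lattice: "(\<Sum>t\<in>?T. moebius (L ?K) t (snd p) * (if snd v \<le> t then 1 else 0))
      = (if snd v = snd p then 1 else 0)" if "fst v = ?K"
  proof -
    have "(\<Sum>t\<in>?T. moebius (L ?K) t (snd p) * (if snd v \<le> t then 1 else 0))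
      = (\<Sum>t | t \<in> L ?K \<and> snd v \<le> t \<and> t \<le> snd p. moebius (L ?K) t (snd p))"
      by (rule sum.mono_neutral_cong_right) auto
    also have "\<dots> = (if snd v = snd p then 1 else 0)"
    proof (cases "snd v \<le> snd p")
      case True
      then show ?thesis using sum_moebius_left[of "L ?K" "snd v" "snd p"] pD(3) vD(3) that by simp
    next
      case False
      then have "{t. t \<in> L ?K \<and> snd v \<le> t \<and> t \<le> snd p} = {}" using order_trans by blast
      with False show ?thesis by (simp only: sum.empty) auto
    qed
    finally show ?thesis .
  qed
  have "(\<Sum>t\<in>?T. moebius (L ?K) t (snd p) *
      (\<Sum>U\<in>subgroups_of G ?K. moebius ?S U ?K * (if fst v \<subseteq> U \<and> snd v \<le> t then 1 else 0)))
    = (\<Sum>t\<in>?T. moebius (L ?K) t (snd p) * (if snd v \<le> t then 1 else 0) * (if fst v = ?K then 1 else 0))"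
    by (rule sum.cong[OF refl]) (simp add: groups[symmetric])
  also have "\<dots> = (if fst v = ?K then 1 else 0) *
      (\<Sum>t\<in>?T. moebius (L ?K) t (snd p) * (if snd v \<le> t then 1 else 0))"
    unfolding sum_distrib_left by (simp only: mult.commute)
  also have "\<dots> = (if v = p then 1 else 0)"
    using lattice by (auto simp: prod_eq_iff)
  finally show ?thesis .
qed

lemma idem_eq:
  "idem G act L H R p =
    scale (1 / of_nat (card (pair_normalizer G act H p)))
      (\<Sum>t | t \<in> L (fst p) \<and> t \<le> snd p. scale (of_int (moebius (L (fst p)) t (snd p)))
        (\<Sum>U\<in>subgroups_of G (fst p).
          scale (of_nat (card U) * of_int (moebius (subgroups_of G (carrier G)) U (fst p)))
            (basis G act H R (cut U t))))"
  by (simp add: idem_def cut_def split: prod.split)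

lemma marks_add: "marks (x + y) w = marks x w + marks y w"
  and marks_scale: "marks (scale c x) w = c * marks x w"
  and marks_sum: "marks (sum f A) w = (\<Sum>a\<in>A. marks (f a) w)"
  and marks_zero: "marks 0 w = 0"
  and marks_diff: "marks (x - y) w = marks x w - marks y w"
  by (simp_all add: marks_def lin_form_add lin_form_scale lin_form_sum lin_form_diff)

lemma cut_below_mem:
  assumes "p \<in> P" "U \<in> subgroups_of G (fst p)" "t \<in> L (fst p)"
  shows "cut U t \<in> P"
  using assms P_D(1,2)[OF assms(1)] by (intro cut_mem) (auto simp: subgroups_of_def)

lemma keys_scale: "Poly_Mapping.keys (scale c x) \<subseteq> Poly_Mapping.keys x"
  by (auto simp: in_keys_iff)

lemma keys_idem:
  assumes p: "p \<in> P"
  shows "Poly_Mapping.keys (idem G act L H R p) \<subseteq> R"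
proof -
  have sum: "Poly_Mapping.keys (sum f A) \<subseteq> R" if "\<And>a. a \<in> A \<Longrightarrow> Poly_Mapping.keys (f a) \<subseteq> R"
    for f :: "'d \<Rightarrow> ('g set \<times> 'l \<Rightarrow>\<^sub>0 rat)" and A
    using order_trans[OF Poly_Mapping.keys_sum UN_least[OF that]] .
  show ?thesis unfolding idem_eq
  proof (intro order_trans[OF keys_scale] sum)
    fix t U assume "t \<in> {t. t \<in> L (fst p) \<and> t \<le> snd p}" "U \<in> subgroups_of G (fst p)"
    then show "Poly_Mapping.keys (basis G act H R (cut U t)) \<subseteq> R"
      by (intro keys_basis cut_below_mem[OF p]) auto
  qed
qed

text \<open>The factor \<open>|U|\<close> turns the mark of \<open>(U, t)\<close> at \<open>w\<close> into the number of \<open>h \<in> H\<close> with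
  \<open>h\<^sup>-\<^sup>1 \<bullet> w \<le> (U, t)\<close>. By \<open>sum_moebius_pairs\<close>, what remains is the number of \<open>h\<close> with \<open>h\<^sup>-\<^sup>1 \<bullet> w = p\<close>: for
  representatives \<open>w\<close> and \<open>p\<close> this is the order of the normalizer if \<open>w = p\<close>, and \<open>0\<close> otherwise.\<close>

lemma marks_idem:
  assumes p: "p \<in> R" and w: "w \<in> R"
  shows "marks (idem G act L H R p) w = (if w = p then 1 else 0)"
proof -
  note pP = R_P[OF p] and wP = R_P[OF w]
  let ?K = "fst p" and ?S = "subgroups_of G (carrier G)"
  let ?T = "{t. t \<in> L ?K \<and> t \<le> snd p}"
  let ?N = "pair_normalizer G act H p"
  let ?i = "\<lambda>h U t. if fst (inv h \<bullet> w) \<subseteq> U \<and> snd (inv h \<bullet> w) \<le> t then 1 else 0 :: int"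
  have basis: "of_nat (card U) * marks (basis G act H R (cut U t)) w = (of_int (\<Sum>h\<in>H. ?i h U t) :: rat)"
    if "U \<in> subgroups_of G ?K" "t \<in> ?T" for U t
  proof -
    have cP: "cut U t \<in> P" using that by (intro cut_below_mem[OF pP]) auto
    have le: "w \<le> h \<bullet> cut U t \<longleftrightarrow> fst (inv h \<bullet> w) \<subseteq> U \<and> snd (inv h \<bullet> w) \<le> t" if "h \<in> H" for h
      using pair_act_le_move[OF that wP cP] le_cut_iff[OF pair_act_closed[OF _ wP], of "inv h" U t]
        \<open>U \<in> _\<close> that by (simp add: subgroups_of_def)
    have "card U * mark w (cut U t) = card {h. h \<in> H \<and> w \<le> h \<bullet> cut U t}"
      using mark_count[OF cP, of w] by (simp add: cut_def)
    also have "\<dots> = (\<Sum>h\<in>H. if w \<le> h \<bullet> cut U t then 1 else 0)"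
      by (rule card_as_sums) (auto simp: finite_H)
    finally have "int (card U * mark w (cut U t)) = int (\<Sum>h\<in>H. if w \<le> h \<bullet> cut U t then 1 else 0)"
      by (rule arg_cong)
    also have "\<dots> = (\<Sum>h\<in>H. ?i h U t)"
      unfolding of_nat_sum using le by (intro sum.cong) auto
    finally have "int (card U * mark w (cut U t)) = (\<Sum>h\<in>H. ?i h U t)" .
    then show ?thesis
      unfolding marks_basis[OF cP] by (metis of_int_of_nat_eq of_nat_mult)
  qed
  have "marks (idem G act L H R p) w = 1 / of_nat (card ?N) *
      (\<Sum>t\<in>?T. of_int (moebius (L ?K) t (snd p)) * (\<Sum>U\<in>subgroups_of G ?K.
        of_int (moebius ?S U ?K) * (of_nat (card U) * marks (basis G act H R (cut U t)) w)))"
    unfolding idem_eq marks_scale marks_sum by (simp add: mult_ac)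
  also have "\<dots> = 1 / of_nat (card ?N) *
      (\<Sum>t\<in>?T. of_int (moebius (L ?K) t (snd p)) * (\<Sum>U\<in>subgroups_of G ?K.
        of_int (moebius ?S U ?K) * of_int (\<Sum>h\<in>H. ?i h U t)))"
    by (intro arg_cong2[where f = "(*)"] sum.cong refl basis)
  also have "\<dots> = 1 / of_nat (card ?N) * of_int (\<Sum>t\<in>?T. moebius (L ?K) t (snd p) *
      (\<Sum>U\<in>subgroups_of G ?K. moebius ?S U ?K * (\<Sum>h\<in>H. ?i h U t)))"
    by (simp only: of_int_sum of_int_mult)
  also have "(\<Sum>t\<in>?T. moebius (L ?K) t (snd p) *
      (\<Sum>U\<in>subgroups_of G ?K. moebius ?S U ?K * (\<Sum>h\<in>H. ?i h U t)))
    = (\<Sum>t\<in>?T. \<Sum>h\<in>H. moebius (L ?K) t (snd p) * (\<Sum>U\<in>subgroups_of G ?K. moebius ?S U ?K * ?i h U t))"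
    unfolding sum_distrib_left by (intro sum.cong[OF refl] sum.swap)
  also have "\<dots> = (\<Sum>h\<in>H. \<Sum>t\<in>?T. moebius (L ?K) t (snd p) *
      (\<Sum>U\<in>subgroups_of G ?K. moebius ?S U ?K * ?i h U t))"
    by (rule sum.swap)
  also have "\<dots> = (\<Sum>h\<in>H. if inv h \<bullet> w = p then 1 else 0)"
    by (intro sum.cong[OF refl] sum_moebius_pairs[OF pP] pair_act_closed[OF _ wP] H.m_inv_closed)
  also have "\<dots> = (if w = p then int (card ?N) else 0)"
  proof (cases "w = p")
    case True
    have "inv h \<bullet> p = p \<longleftrightarrow> h \<bullet> p = p" if "h \<in> H" for h
      using pair_act_inv[OF that pP] by metis
    then have "(\<Sum>h\<in>H. if inv h \<bullet> w = p then 1 else 0 :: int) = (\<Sum>h\<in>H. if h \<bullet> p = p then 1 else 0)"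
      using True by (intro sum.cong) auto
    also have "\<dots> = int (\<Sum>h\<in>H. if h \<bullet> p = p then 1 else 0)"
      unfolding of_nat_sum by (intro sum.cong) auto
    also have "\<dots> = int (card ?N)"
      using card_as_sums[of ?N H "\<lambda>h. h \<bullet> p = p"] finite_H by (simp add: pair_normalizer_def)
    finally show ?thesis using True by simp
  next
    case False
    have "inv h \<bullet> w \<noteq> p" if "h \<in> H" for h
      using R_unique[OF p w, of "inv h"] that False by auto
    then show ?thesis using False by (simp add: sum.neutral)
  qed
  finally have "marks (idem G act L H R p) w =
      1 / of_nat (card ?N) * of_int (if w = p then int (card ?N) else 0)" .
  moreover have "card ?N > 0"
  proof -
    have "\<one> \<in> ?N" using pair_act_one[OF pP] by (simp add: pair_normalizer_def)
    moreover have "finite ?N" using finite_H by (simp add: pair_normalizer_def)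
    ultimately show ?thesis by (subst card_gt_0_iff) blast
  qed
  ultimately show ?thesis by simp
qed

lemma Omega_rat_simps:
  "carrier (Omega_rat G act L H R) = {x. Poly_Mapping.keys x \<subseteq> R}"
  "\<zero>\<^bsub>Omega_rat G act L H R\<^esub> = 0"
  "x \<otimes>\<^bsub>Omega_rat G act L H R\<^esub> y = burnside_mult x y"
  "x \<oplus>\<^bsub>Omega_rat G act L H R\<^esub> y = x + y"
  by (simp_all add: Omega_rat_def burnside_algebra_def burnside_mult_def)

lemma burnside_mult_eq_iff:
  fixes x y z :: "'g set \<times> 'l \<Rightarrow>\<^sub>0 'c::{idom, ring_char_0}"
  assumes "Poly_Mapping.keys x \<subseteq> R" "Poly_Mapping.keys y \<subseteq> R" "Poly_Mapping.keys z \<subseteq> R"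
  shows "burnside_mult x y = z \<longleftrightarrow> (\<forall>w\<in>R. marks x w * marks y w = marks z w)"
  using marks_eqI[OF keys_burnside_mult[OF assms(1,2)] assms(3)] marks_mult[OF assms(1,2) R_P]
  by (auto simp: burnside_mult_def)

lemma idempotent_marks:
  fixes x :: "'g set \<times> 'l \<Rightarrow>\<^sub>0 'c::{idom, ring_char_0}"
  assumes "Poly_Mapping.keys x \<subseteq> R" "burnside_mult x x = x" "w \<in> R"
  shows "marks x w = 0 \<or> marks x w = 1"
  using assms burnside_mult_eq_iff[of x x x] by (auto simp: mult_cancel_right1)

text \<open>In a decomposition into orthogonal idempotents both summands have marks in \<open>{0, 1}\<close>. Both
  vanish away from \<open>p\<close> and, by orthogonality, one of them vanishes at \<open>p\<close> too.\<close>

lemma primitive_idem: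
  assumes p: "p \<in> R"
  shows "primitive_idempotent (Omega_rat G act L H R) (idem G act L H R p)"
proof -
  let ?e = "idem G act L H R p"
  note ke = keys_idem[OF R_P[OF p]] and me = marks_idem[OF p]
  have ne: "?e \<noteq> 0" using me[OF p] by (auto simp: marks_zero)
  have "False" if f: "Poly_Mapping.keys f \<subseteq> R" "f \<noteq> 0" "burnside_mult f f = f"
    and g: "Poly_Mapping.keys g \<subseteq> R" "g \<noteq> 0" "burnside_mult g g = g"
    and fg: "burnside_mult f g = 0" "?e = f + g" for f g
  proof -
    have sum: "marks f w + marks g w = (if w = p then 1 else 0)" if "w \<in> R" for w
      using me[OF that] fg(2) by (simp add: marks_add)
    have zero: "marks f w = 0" "marks g w = 0" if "w \<in> R" "w \<noteq> p" for w
      using sum[OF that(1)] idempotent_marks[OF f(1,3) that(1)] idempotent_marks[OF g(1,3) that(1)]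
        that(2) by auto
    have "marks f p = 0 \<or> marks g p = 0"
      using burnside_mult_eq_iff[OF f(1) g(1), of 0] fg(1) p by (simp add: marks_zero)
    then show False
    proof
      assume "marks f p = 0"
      then have "f = 0" using zero by (intro marks_zero_imp_zero[OF f(1)]) metis
      then show False using f by simp
    next
      assume "marks g p = 0"
      then have "g = 0" using zero by (intro marks_zero_imp_zero[OF g(1)]) metis
      then show False using g by simp
    qed
  qed
  moreover have "burnside_mult ?e ?e = ?e"
    using burnside_mult_eq_iff[OF ke ke ke] me by simp
  ultimately show ?thesis
    unfolding primitive_idempotent_def Omega_rat_simps using ke ne by blast
qed

text \<open>If an idempotent \<open>e\<close> has mark \<open>1\<close> at \<open>p\<close>, then \<open>idem p\<close> and \<open>e - idem p\<close> are orthogonal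
  idempotents with sum \<open>e\<close>.\<close>

lemma primitive_is_idem:
  assumes "primitive_idempotent (Omega_rat G act L H R) e"
  shows "\<exists>p\<in>R. e = idem G act L H R p"
proof -
  have e: "Poly_Mapping.keys e \<subseteq> R" "e \<noteq> 0" "burnside_mult e e = e"
    and prim: "\<And>f g. Poly_Mapping.keys f \<subseteq> R \<Longrightarrow> Poly_Mapping.keys g \<subseteq> R \<Longrightarrow> f \<noteq> 0 \<Longrightarrow> g \<noteq> 0 \<Longrightarrow>
      burnside_mult f f = f \<Longrightarrow> burnside_mult g g = g \<Longrightarrow>
      burnside_mult f g = 0 \<Longrightarrow> burnside_mult g f = 0 \<Longrightarrow> e \<noteq> f + g"
    using assms unfolding primitive_idempotent_def Omega_rat_simps by blast+
  obtain p where p: "p \<in> R" "marks e p \<noteq> 0"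
    using marks_zero_imp_zero[OF e(1)] e(2) by blast
  then have ep: "marks e p = 1" using idempotent_marks[OF e(1,3)] by blast
  let ?f = "idem G act L H R p"
  let ?g = "e - ?f"
  note kf = keys_idem[OF R_P[OF p(1)]] and mf = marks_idem[OF p(1)]
  have kg: "Poly_Mapping.keys ?g \<subseteq> R" using Poly_Mapping.keys_diff[of e ?f] e(1) kf by blast
  have k0: "Poly_Mapping.keys (0 :: 'g set \<times> 'l \<Rightarrow>\<^sub>0 rat) \<subseteq> R" by simp
  have mg: "marks ?g w = (if w = p then 0 else marks e w)" if "w \<in> R" for w
    using that mf ep by (simp add: marks_diff)
  have sq: "marks e w * marks e w = marks e w" if "w \<in> R" for w
    using burnside_mult_eq_iff[OF e(1,1,1)] e(3) that by blast
  have "?f \<noteq> 0" using mf[OF p(1)] by (auto simp: marks_zero)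
  moreover have "burnside_mult ?f ?f = ?f" unfolding burnside_mult_eq_iff[OF kf kf kf] using mf by simp
  moreover have "burnside_mult ?g ?g = ?g" unfolding burnside_mult_eq_iff[OF kg kg kg] using mg sq by simp
  moreover have "burnside_mult ?f ?g = 0" "burnside_mult ?g ?f = 0"
    unfolding burnside_mult_eq_iff[OF kf kg k0] burnside_mult_eq_iff[OF kg kf k0]
    using mf mg by (simp_all add: marks_zero)
  ultimately have "?g = 0" using prim[OF kf kg] by force
  then show ?thesis using p(1) by auto
qed

lemma bij_betw_idem:
  "bij_betw (idem G act L H R) R {e. primitive_idempotent (Omega_rat G act L H R) e}"
proof (rule bij_betw_imageI)
  show "inj_on (idem G act L H R) R"
  proof (rule inj_onI)
    fix p q assume pq: "p \<in> R" "q \<in> R" "idem G act L H R p = idem G act L H R q"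
    then have "(if p = q then 1 else 0 :: rat) = 1"
      using marks_idem[of q p] marks_idem[of p p] by simp
    then show "p = q" by (auto split: if_splits)
  qed
  show "idem G act L H R ` R = {e. primitive_idempotent (Omega_rat G act L H R) e}"
    using primitive_idem primitive_is_idem by blast
qed

end

theorem theorem4p12:
  fixes G :: "('g, 'm) monoid_scheme"
    and act :: "'g \<Rightarrow> 'l \<Rightarrow> 'l::{finite, lattice}"
    and L :: "'g set \<Rightarrow> 'l set"
    and H :: "'g set"
    and C :: "'g set set"
    and R :: "('g set \<times> 'l) set"
  assumes "group G" and "finite (carrier G)"
    and "admissible_family G act L"
    and "subgroup H G"
    and "pair_reps G act L H C R"
  shows "rho G act L H \<in> carrier (Omega G act L H R) \<rightarrow> carrier (Mho G act L H) \<and>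
         zeta L R \<in> carrier (Mho G act L H) \<rightarrow> carrier (Omega_tilde R) \<and>
         (\<forall>x\<in>carrier (Omega G act L H R).
               (alpha G act L H R \<circ> phi G act L H R) x = (zeta L R \<circ> rho G act L H) x) \<and>
         ring_hom_ring (Omega G act L H R) (Omega_tilde R) (alpha G act L H R \<circ> phi G act L H R) \<and>
         inj_on (alpha G act L H R \<circ> phi G act L H R) (carrier (Omega G act L H R)) \<and>
         bij_betw (idem G act L H R) R {e. primitive_idempotent (Omega_rat G act L H R) e}"
proof -
  interpret admissible_family G act L by fact
  interpret burnside_basis G act L H R
    by (intro burnside_basis.intro burnside_pairs.intro burnside_basis_axioms.intro
        burnside_pairs_axioms.intro)
      (use assms in \<open>simp_all add: pair_reps_def\<close>)
  have carrier: "carrier (Omega G act L H R) = {x. Poly_Mapping.keys x \<subseteq> R}"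
    by (simp add: Omega_def burnside_algebra_def)
  have "(alpha G act L H R \<circ> phi G act L H R) x = (zeta L R \<circ> rho G act L H) x"
    if "Poly_Mapping.keys x \<subseteq> R" for x
  proof
    fix p
    show "(alpha G act L H R \<circ> phi G act L H R) x p = (zeta L R \<circ> rho G act L H) x p"
    proof (cases "p \<in> R")
      case True
      then show ?thesis using zeta_rho_eq[OF that] by simp
    next
      case False
      \<comment> \<open>off \<open>R\<close> both families have the default value\<close>
      then show ?thesis by (cases p) (simp add: alpha_def zeta_def)
    qed
  qed
  moreover have "rho G act L H \<in> carrier (Omega G act L H R) \<rightarrow> carrier (Mho G act L H)"
    using rho_Mho by (simp add: carrier)
  moreover have "zeta L R \<in> carrier (Mho G act L H) \<rightarrow> carrier (Omega_tilde R)"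
    by (auto simp: zeta_def Omega_tilde_def product_ring_def)
  ultimately show ?thesis
    using ring_hom_marks inj_alpha_phi bij_betw_idem by (simp add: carrier)
qed

end
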